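(* Let $E\subset\mathbb{C}$ be a compact set that is symmetric with respect to the real axis and regular for the Dirichlet problem. The following are equivalent: (i) $\mathrm{cap}(E)\ge 1$. (ii) For every open neighborhood $U$ of the polynomially convex hull $\mathrm{Pc}(E)$ there exists a sequence of monic polynomials $P_n\in\mathbb{Z}[z]$ with $\deg(P_n)\to\infty$ such that the filled Julia sets satisfy $K_{P_n}\subset U$ for all sufficiently large $n$.
   Context: $\mathrm{cap}(E)$ is the logarithmic capacity: $-\log\mathrm{cap}(E)=\inf_{\nu}\iint\log\frac{1}{|z-w|}\,d\nu(z)\,d\nu(w)$, the infimum being over Borel probability measures $\nu$ on $E$. $E$ symmetric with respect to the real axis means $z\in E\Rightarrow\bar z\in E$. The polynomially convex hull $\mathrm{Pc}(E)$ is the complement in $\mathbb{C}$ of the unbounded component of $\mathbb{C}\setminus E$. $E$ is regular for the Dirichlet problem if it is non-polar and the unbounded component $\Omega_E$ of $\widehat{\mathbb{C}}\setminus E$ is a regular domain for the Dirichlet problem; equivalently, $\mathrm{cap}(E)>0$ and the Green function $g_E(z)=\int\log|z-\zeta|\,d\mu_E(\zeta)-\log\mathrm{cap}(E)$ (with $\mu_E$ the equilibrium measure of $E$) is continuous on $\mathbb{C}$ and vanishes identically on $\mathrm{Pc}(E)$. For a polynomial $P\in\mathbb{C}[z]$ of degree $\ge 2$, the filled Julia set is $K_P=\{z\in\mathbb{C}:\ \{P^{\circ n}(z)\}_{n\ge 0}\text{ is bounded}\}$, where $P^{\circ n}$ is the $n$-th iterate. *)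

theory Defs
  imports "HOL-Complex_Analysis.Complex_Analysis" "HOL-Probability.Probability"
begin

definition prob_measures_on :: "complex set \<Rightarrow> complex measure set" where
  "prob_measures_on E = {\<nu>. sets \<nu> = sets borel \<and> prob_space \<nu> \<and> emeasure \<nu> E = 1}"

definition log_kernel :: "complex \<Rightarrow> complex \<Rightarrow> ereal" where
  "log_kernel z w = (if z = w then \<infinity> else ereal (ln (1 / cmod (z - w))))"

(* The double integral of log_kernel, as the integral of the positive part minus the integral of
   the negative part (e2ennreal sends negative values to 0).  If \<nu> lives on a bounded set, the
   second integral is finite, so the difference is a well-defined element of (-\<infinity>, \<infinity>]. *)
definition log_energy :: "complex measure \<Rightarrow> ereal" where
  "log_energy \<nu> =
     enn2ereal (\<integral>\<^sup>+ w. (\<integral>\<^sup>+ z. e2ennreal (log_kernel z w) \<partial>\<nu>) \<partial>\<nu>)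
     - enn2ereal (\<integral>\<^sup>+ w. (\<integral>\<^sup>+ z. e2ennreal (- log_kernel z w) \<partial>\<nu>) \<partial>\<nu>)"

definition robin_constant :: "complex set \<Rightarrow> ereal" where
  "robin_constant E = (INF \<nu>\<in>prob_measures_on E. log_energy \<nu>)"

(* exp (- robin_constant E), with exp (- \<infinity>) = 0.  Meant for compact E, where
   robin_constant E > - \<infinity>. *)
definition capacity :: "complex set \<Rightarrow> real" where
  "capacity E =
     (if robin_constant E = \<infinity> then 0 else exp (- real_of_ereal (robin_constant E)))"

definition polar :: "complex set \<Rightarrow> bool" where
  "polar E \<longleftrightarrow> (\<forall>\<nu>\<in>prob_measures_on E. log_energy \<nu> = \<infinity>)"

(* Twice continuously differentiable with vanishing Laplacian. *)
definition harmonic_on :: "complex set \<Rightarrow> (complex \<Rightarrow> real) \<Rightarrow> bool" where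
  "harmonic_on S u \<longleftrightarrow> open S \<and>
     (\<exists>ux uy uxx uxy uyx uyy :: complex \<Rightarrow> real.
        (\<forall>z\<in>S.
           (u has_derivative (\<lambda>h. ux z * Re h + uy z * Im h)) (at z) \<and>
           (ux has_derivative (\<lambda>h. uxx z * Re h + uxy z * Im h)) (at z) \<and>
           (uy has_derivative (\<lambda>h. uyx z * Re h + uyy z * Im h)) (at z) \<and>
           uxx z + uyy z = 0) \<and>
        continuous_on S uxx \<and> continuous_on S uxy \<and>
        continuous_on S uyx \<and> continuous_on S uyy)"

(* D stands for the domain D \<union> {\<infinity>} of the Riemann sphere, where D contains a punctured
   neighbourhood of \<infinity>.  A function on D \<union> {\<infinity>} is given by u on D and the value c at \<infinity>;
   it is harmonic there iff u is harmonic on D and, in the coordinate w = 1/z, it is harmonic on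
   the image of (D - {0}) \<union> {\<infinity>}.  Since \<infinity> is an interior point, the boundary in the sphere
   is the frontier of D in the plane. *)
definition harmonic_on_with_infinity :: "complex set \<Rightarrow> (complex \<Rightarrow> real) \<Rightarrow> bool" where
  "harmonic_on_with_infinity D u \<longleftrightarrow>
     harmonic_on D u \<and>
     (\<exists>c. harmonic_on (insert 0 (inverse ` (D - {0}))) (\<lambda>w. if w = 0 then c else u (inverse w)))"

definition dirichlet_regular_domain :: "complex set \<Rightarrow> bool" where
  "dirichlet_regular_domain D \<longleftrightarrow>
     (\<forall>\<phi> :: complex \<Rightarrow> real. continuous_on (frontier D) \<phi> \<longrightarrow>
        (\<exists>u. continuous_on (closure D) u \<and> (\<forall>z\<in>frontier D. u z = \<phi> z) \<and>
             harmonic_on_with_infinity D u))"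

(* For bounded E, outside E is the unbounded component of the complement of E. *)
definition regular_for_dirichlet :: "complex set \<Rightarrow> bool" where
  "regular_for_dirichlet E \<longleftrightarrow> \<not> polar E \<and> dirichlet_regular_domain (outside E)"

definition poly_convex_hull :: "complex set \<Rightarrow> complex set" where
  "poly_convex_hull E = - outside E"

definition filled_julia :: "complex poly \<Rightarrow> complex set" where
  "filled_julia P = {z. bounded (range (\<lambda>n. (poly P ^^ n) z))}"

end

theory Submission
  imports Defs "HOL-Computational_Algebra.Fundamental_Theorem_Algebra"
begin

text \<open>
  Regularity plays no role: everything rests on discrete versions of the capacity.

  If \<open>cap E \<ge> 1\<close>, there are measures on \<open>E\<close> of energy at most \<open>\<epsilon>\<close>, and choosing points one by one not
  above the average shows that the largest Vandermonde determinants of \<open>n\<close> points of \<open>E\<close> are at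
  least 1.  For nearly extremal points, Lagrange interpolation of the constant 1 bounds the
  node polynomial from below away from \<open>E\<close>, and dilating the nodes slightly makes it larger than 1
  there.  Multiplying by the conjugate polynomial and perturbing gives such a polynomial \<open>q\<close> with
  rational coefficients.  Following Fekete and Szego, suitable powers \<open>q\<^sup>N\<close> have many integral leading
  coefficients, and the remaining ones can be rounded at the cost of a lower-order error, by
  subtracting small multiples of the polynomials \<open>z\<^sup>i q\<^sup>k\<close>.  The resulting integer polynomial is so large
  off the given neighbourhood that all points there escape.

  Conversely, if no monic \<open>q\<close> satisfies \<open>\<bar>q\<bar> < 1\<close> on \<open>E\<close>, a Leja sequence in \<open>E\<close> equidistributes (along a
  subsequence) to a measure of energy at most 0.  Otherwise \<open>{\<bar>q\<bar> < 1}\<close> is a neighbourhood of the hull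
  that contains no filled Julia set of a monic polynomial, by computing a resultant.
\<close>

section \<open>Filled Julia sets of monic polynomials\<close>

text \<open>With \<open>S\<close> the sum of the moduli of the lower coefficients, those terms
  contribute at most \<open>S * cmod z ^ (m - 1)\<close>, half of the leading term once
  \<open>cmod z \<ge> 1 + 2 * S\<close>.\<close>

lemma monic_poly_growth:
  fixes p :: "complex poly"
  assumes "lead_coeff p = 1"
  obtains R where "R \<ge> 1" "\<And>z. cmod z \<ge> R \<Longrightarrow> cmod (poly p z) \<ge> cmod z ^ degree p / 2"
proof -
  define m where "m = degree p"
  define S where "S = (\<Sum>i<m. cmod (coeff p i))"
  have S: "S \<ge> 0" unfolding S_def by (intro sum_nonneg) auto
  have "cmod (poly p z) \<ge> cmod z ^ m / 2" if z: "cmod z \<ge> 1 + 2 * S" for z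
  proof (cases "m = 0")
    case True
    then obtain c where "p = [:c:]" by (metis degree_eq_zeroE m_def)
    then show ?thesis using assms True by simp
  next
    case False
    then obtain k where k: "m = Suc k" by (cases m) auto
    have z1: "cmod z \<ge> 1" using z S by linarith
    have "poly p z = (\<Sum>i<m. coeff p i * z ^ i) + z ^ m"
      using assms unfolding poly_altdef m_def[symmetric]
      by (simp add: lessThan_Suc_atMost[symmetric] m_def)
    moreover have "cmod (\<Sum>i<m. coeff p i * z ^ i) \<le> (\<Sum>i<m. cmod (coeff p i) * cmod z ^ k)"
      by (rule sum_norm_le)
         (use z1 k in \<open>auto simp: norm_mult norm_power intro!: mult_left_mono power_increasing\<close>)
    moreover have "(\<Sum>i<m. cmod (coeff p i) * cmod z ^ k) = S * cmod z ^ k"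
      unfolding S_def by (simp add: sum_distrib_right)
    moreover have "S * cmod z ^ k \<le> cmod z / 2 * cmod z ^ k"
      by (rule mult_right_mono) (use z in auto)
    moreover have "cmod z / 2 * cmod z ^ k = cmod z ^ m / 2" by (simp add: k)
    moreover have "cmod (z ^ m) \<le> cmod ((\<Sum>i<m. coeff p i * z ^ i) + z ^ m) + cmod (\<Sum>i<m. coeff p i * z ^ i)"
      using norm_triangle_ineq4[of "(\<Sum>i<m. coeff p i * z ^ i) + z ^ m" "\<Sum>i<m. coeff p i * z ^ i"] by simp
    ultimately show ?thesis by (simp add: norm_power)
  qed
  then show thesis using that[of "1 + 2 * S"] S m_def by simp
qed

lemma monic_poly_escape:
  fixes p :: "complex poly"
  assumes "lead_coeff p = 1" "degree p \<ge> 2"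
  obtains R where "R \<ge> 1" "\<And>z. cmod z \<ge> R \<Longrightarrow> cmod (poly p z) \<ge> 2 * cmod z"
proof -
  obtain R where R: "R \<ge> 1" "\<And>z. cmod z \<ge> R \<Longrightarrow> cmod (poly p z) \<ge> cmod z ^ degree p / 2"
    using monic_poly_growth[OF assms(1)] by blast
  \<comment> \<open>The 4 makes \<open>cmod z ^ 2 / 2\<close> at least
    \<open>2 * cmod z\<close>.\<close>
  have "cmod (poly p z) \<ge> 2 * cmod z" if z: "cmod z \<ge> max R 4" for z
  proof -
    have "4 * cmod z \<le> cmod z * cmod z" using z by (intro mult_right_mono) auto
    then have "2 * cmod z \<le> cmod z ^ 2 / 2" by (simp add: power2_eq_square)
    also have "cmod z ^ 2 \<le> cmod z ^ degree p" by (rule power_increasing) (use assms z in auto)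
    finally show ?thesis using R(2)[of z] z by auto
  qed
  then show thesis using that[of "max R 4"] R(1) by auto
qed

lemma monic_poly_iterate:
  fixes p :: "complex poly"
  assumes "lead_coeff p = 1" "degree p > 0"
  obtains q where "lead_coeff q = 1" "degree q > 0" "poly q = poly p ^^ n"
proof -
  have "\<exists>q. lead_coeff q = 1 \<and> degree q > 0 \<and> poly q = poly p ^^ n"
  proof (induction n)
    case 0
    show ?case by (rule exI[of _ "[:0, 1:]"]) (auto simp: fun_eq_iff)
  next
    case (Suc n)
    then obtain q where "lead_coeff q = 1" "degree q > 0" "poly q = poly p ^^ n" by blast
    moreover from this have "lead_coeff (p \<circ>\<^sub>p q) = 1"
      using assms by (subst lead_coeff_comp) auto
    ultimately show ?case using assms
      by (intro exI[of _ "p \<circ>\<^sub>p q"]) (auto simp: degree_pcompose poly_pcompose fun_eq_iff)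
  qed
  then show thesis using that by blast
qed

text \<open>The sublevel sets of the iterates are compact and, by the escape condition, decreasing;
  a point common to all of them has an orbit bounded by \<open>R\<close>. By compactness one of them
  already lies in \<open>U\<close>.\<close>

lemma filled_julia_sublevel:
  fixes p :: "complex poly"
  assumes esc: "\<And>z. cmod z \<ge> R \<Longrightarrow> cmod (poly p z) \<ge> 2 * cmod z" and R: "R \<ge> 1"
    and U: "open U" "filled_julia p \<subseteq> U"
  obtains n where "{z. cmod ((poly p ^^ n) z) \<le> R} \<subseteq> U"
proof (rule ccontr)
  assume neg: "\<not> thesis"
  define L where "L n = {z. cmod ((poly p ^^ n) z) \<le> R}" for n
  have cont: "continuous_on UNIV (poly p ^^ n)" for n
  proof (induction n)
    case (Suc n)
    then show ?case using continuous_on_compose[of UNIV "poly p ^^ n" "poly p"]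
      by (auto simp: o_def intro!: continuous_intros)
  qed (auto simp: id_def)
  have closed: "closed (L n)" for n
  proof -
    have "closed ((\<lambda>z. cmod ((poly p ^^ n) z)) -` {..R})"
      using continuous_on_norm[OF cont] by (intro continuous_closed_vimage) (auto simp: continuous_on_eq_continuous_at)
    then show ?thesis by (simp add: L_def vimage_def)
  qed
  have mono1: "L (Suc n) \<subseteq> L n" for n
  proof
    fix z assume "z \<in> L (Suc n)"
    then have le: "cmod (poly p ((poly p ^^ n) z)) \<le> R" by (simp add: L_def)
    have "cmod ((poly p ^^ n) z) \<le> R"
    proof (rule ccontr)
      assume "\<not> ?thesis"
      then show False using esc[of "(poly p ^^ n) z"] le R by simp
    qed
    then show "z \<in> L n" by (simp add: L_def)
  qed
  have mono: "L n \<subseteq> L m" if "m \<le> n" for m n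
    using lift_Suc_antimono_le[of L, OF mono1] that by blast
  have "bounded (L 0)" by (auto simp: L_def bounded_iff)
  then have "compact (L n)" for n
    using closed[of n] mono[of 0 n] bounded_subset[of "L 0" "L n"] by (simp add: compact_eq_bounded_closed)
  then have "compact (L n - U)" for n using U(1) by (rule compact_diff)
  moreover have "L n - U \<noteq> {}" for n using neg that unfolding L_def by blast
  ultimately have "(\<Inter>n. L n - U) \<noteq> {}"
    by (intro compact_nest Diff_mono mono order_refl)
  then obtain z where z: "\<And>n. z \<in> L n" "z \<notin> U" by blast
  then have "z \<in> filled_julia p"
    unfolding filled_julia_def L_def by (auto simp: bounded_iff)
  then show False using z U by blast
qed

section \<open>Multisets of roots and the resultant argument\<close>

lemma monic_poly_roots:
  fixes p :: "complex poly"
  assumes "lead_coeff p = 1"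
  obtains A where "size A = degree p" "p = (\<Prod>a\<in>#A. [:-a, 1:])"
  using alg_closed_imp_factorization[of p] assms by force

lemma poly_prod_mset_linear:
  "poly (\<Prod>a\<in>#A. [:-a, 1:]) z = (\<Prod>a\<in>#A. z - a)" for z :: "'a :: comm_ring_1"
  by (induction A) (auto simp: algebra_simps)

lemma norm_prod_mset:
  "norm (\<Prod>a\<in>#A. f a) = (\<Prod>a\<in>#A. norm (f a))" for f :: "_ \<Rightarrow> 'b :: {real_normed_div_algebra, comm_ring_1}"
  by (induction A) (auto simp: norm_mult)

lemma prod_mset_swap:
  "(\<Prod>a\<in>#A. \<Prod>b\<in>#B. f a b) = (\<Prod>b\<in>#B. \<Prod>a\<in>#A. f a b)" for f :: "_ \<Rightarrow> _ \<Rightarrow> 'c :: comm_monoid_mult"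
  by (induction A) (auto simp: prod_mset.distrib)

lemma prod_mset_less_1:
  fixes f :: "'a \<Rightarrow> real"
  assumes "A \<noteq> {#}" "\<And>a. a \<in># A \<Longrightarrow> 0 \<le> f a \<and> f a < 1"
  shows "(\<Prod>a\<in>#A. f a) < 1"
proof -
  have "A = {#} \<or> (0 \<le> (\<Prod>a\<in>#A. f a) \<and> (\<Prod>a\<in>#A. f a) < 1)" using assms(2)
  proof (induction A)
    case (add x A)
    then show ?case
      using mult_strict_mono'[of "f x" 1 "\<Prod>a\<in>#A. f a" 1] by (cases "A = {#}") auto
  qed auto
  then show ?thesis using assms(1) by auto
qed

lemma prod_mset_ge_1:
  fixes f :: "'a \<Rightarrow> real"
  assumes "\<And>a. a \<in># A \<Longrightarrow> f a \<ge> 1"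
  shows "(\<Prod>a\<in>#A. f a) \<ge> 1"
  using assms
proof (induction A)
  case (add x A)
  have "1 \<le> f x" "1 \<le> (\<Prod>a\<in>#A. f a)" using add by auto
  then show ?case using mult_mono[of 1 "f x" 1 "\<Prod>a\<in>#A. f a"] by simp
qed auto

text \<open>Pigeonhole: the open unit discs about 0, 2, ..., \<open>2 * card A\<close> are disjoint
  and outnumber the points of \<open>A\<close> by one.\<close>

lemma finite_avoid_unit_discs:
  fixes A :: "complex set"
  assumes "finite A"
  obtains w where "cmod w \<le> 2 * real (card A)" "\<And>a. a \<in> A \<Longrightarrow> cmod (a - w) \<ge> 1"
proof (rule ccontr)
  assume neg: "\<not> thesis"
  have "\<forall>j\<le>card A. \<exists>a\<in>A. cmod (a - of_nat (2 * j)) < 1"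
    proof (intro allI impI, rule ccontr)
      fix j assume j: "j \<le> card A" "\<not> (\<exists>a\<in>A. cmod (a - of_nat (2 * j)) < 1)"
      then have "cmod (a - of_nat (2 * j)) \<ge> 1" if "a \<in> A" for a using that by (meson not_le)
      moreover have "cmod (of_nat (2 * j)) \<le> 2 * real (card A)" using j(1) unfolding norm_of_nat by simp
      ultimately show False using neg that by blast
    qed
  then obtain g where g: "\<And>j. j \<le> card A \<Longrightarrow> g j \<in> A \<and> cmod (g j - of_nat (2 * j)) < 1"
    by metis
  have "inj_on g {..card A}"
  proof (rule inj_onI)
    fix i j assume ij: "i \<in> {..card A}" "j \<in> {..card A}" "g i = g j"
    have "cmod (of_nat (2 * i) - of_nat (2 * j)) < 2"
      using norm_triangle_ineq4[of "g j - of_nat (2 * j)" "g i - of_nat (2 * i)"] g[of i] g[of j] ij by simp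
    moreover have "of_nat (2 * i) - of_nat (2 * j) = complex_of_real (2 * (real i - real j))" by simp
    ultimately have "\<bar>2 * (real i - real j)\<bar> < 2" by (metis norm_of_real)
    then have "\<bar>real i - real j\<bar> < 1" by (simp only: abs_mult) simp
    then show "i = j" by linarith
  qed
  moreover have "g ` {..card A} \<subseteq> A" using g by auto
  ultimately show False using card_inj_on_le[OF _ _ assms, of g "{..card A}"] by auto
qed

text \<open>The resultant of \<open>\<Prod>(z - b)\<close> and \<open>q - w\<close>, where \<open>q\<close> is an iterate of \<open>p\<close> and \<open>w\<close> is a suitable
  constant, would be both smaller than 1 and at least 1 in absolute value.\<close>
lemma filled_julia_not_in_lemniscate:
  fixes p :: "complex poly"
  assumes p: "lead_coeff p = 1" "degree p \<ge> 2"
    and sub: "filled_julia p \<subseteq> {z. cmod (\<Prod>b\<in>#B. z - b) < 1}"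
  shows False
proof -
  obtain R0 where R0: "R0 \<ge> 1" "\<And>z. cmod z \<ge> R0 \<Longrightarrow> cmod (poly p z) \<ge> 2 * cmod z"
    using monic_poly_escape[OF p] by blast
  \<comment> \<open>Points beyond this radius escape, and the disc contains every \<open>w\<close>
    that \<open>finite_avoid_unit_discs\<close> may return.\<close>
  define R where "R = max R0 (2 * real (size B))"
  have "continuous_on UNIV (\<lambda>z. poly (\<Prod>b\<in>#B. [:-b, 1:]) z)" by (intro continuous_intros)
  then have op: "open {z. cmod (\<Prod>b\<in>#B. z - b) < 1}"
    unfolding poly_prod_mset_linear by (intro open_Collect_less continuous_intros)
  obtain n where n: "{z. cmod ((poly p ^^ n) z) \<le> R} \<subseteq> {z. cmod (\<Prod>b\<in>#B. z - b) < 1}"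
    by (rule filled_julia_sublevel[of R p, OF _ _ op sub]) (use R0 in \<open>auto simp: R_def\<close>)
  obtain q where q: "lead_coeff q = 1" "degree q > 0" "poly q = poly p ^^ n"
    using monic_poly_iterate[of p n] p by auto
  define C where "C = poly q ` set_mset B"
  have "card C \<le> size B"
  proof -
    have "card (set_mset B) \<le> size B" by (induction B) (auto simp: card_insert_if)
    then show ?thesis unfolding C_def using card_image_le[of "set_mset B" "poly q"] by auto
  qed
  moreover obtain w where w: "cmod w \<le> 2 * real (card C)" "\<And>a. a \<in> C \<Longrightarrow> cmod (a - w) \<ge> 1"
    using finite_avoid_unit_discs[of C] by (auto simp: C_def)
  ultimately have wR: "cmod w \<le> R" by (simp add: R_def)
  have lc: "lead_coeff (q - [:w:]) = 1" "degree (q - [:w:]) = degree q"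
  proof -
    show 1: "degree (q - [:w:]) = degree q" using q(2)
      by (metis degree_add_eq_left degree_minus degree_pCons_0 diff_conv_add_uminus)
    show "lead_coeff (q - [:w:]) = 1" using q unfolding 1 by (auto simp: coeff_pCons split: nat.splits)
  qed
  obtain A where A: "size A = degree (q - [:w:])" "q - [:w:] = (\<Prod>a\<in>#A. [:-a, 1:])"
    by (rule monic_poly_roots[OF lc(1)])
  have A': "poly q z - w = (\<Prod>a\<in>#A. z - a)" for z
    using arg_cong[OF A(2), of "\<lambda>r. poly r z"] by (simp add: poly_prod_mset_linear)
  \<comment> \<open>Roots of \<open>q - w\<close> satisfy
    \<open>cmod (poly q a) = cmod w \<le> R\<close>, so they lie in the sublevel set, which is
    inside the lemniscate.\<close>
  have root: "cmod (\<Prod>b\<in>#B. a - b) < 1" if "a \<in># A" for a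
  proof -
    have "0 \<in># image_mset (\<lambda>x. a - x) A" using that by force
    then have "(\<Prod>x\<in>#A. a - x) = 0" by (simp only: prod_mset_zero_iff)
    then have "poly q a - w = 0" using A'[of a] by simp
    then have "poly q a = w" by simp
    then show ?thesis using n wR q(3) by auto
  qed
  have "A \<noteq> {#}" using A(1) q(2) lc(2) by auto
  then have "(\<Prod>a\<in>#A. cmod (\<Prod>b\<in>#B. a - b)) < 1"
    using root by (intro prod_mset_less_1) auto
  \<comment> \<open>The resultant is read in two ways: over the roots of \<open>q - w\<close> every
    factor is below 1, over \<open>B\<close> every factor is at least 1 by the choice of
    \<open>w\<close>.\<close>
  also have "(\<Prod>a\<in>#A. cmod (\<Prod>b\<in>#B. a - b)) = (\<Prod>b\<in>#B. \<Prod>a\<in>#A. cmod (b - a))"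
    by (subst prod_mset_swap) (simp add: norm_prod_mset norm_minus_commute)
  also have "\<dots> = (\<Prod>b\<in>#B. cmod (poly q b - w))"
    by (simp add: A' norm_prod_mset)
  also have "\<dots> \<ge> 1" by (rule prod_mset_ge_1) (use w(2) in \<open>auto simp: C_def\<close>)
  finally show False by simp
qed

text \<open>Maximum modulus principle on \<open>inside E\<close>, whose frontier lies in
  \<open>E\<close>. Compactness of \<open>E\<close> provides a maximum of \<open>cmod (f z)\<close>
  that is still below 1.\<close>

lemma lemniscate_contains_poly_convex_hull:
  assumes E: "compact E" and less: "\<And>z. z \<in> E \<Longrightarrow> cmod (f z) < 1"
    and f: "f holomorphic_on UNIV"
  shows "poly_convex_hull E \<subseteq> {z. cmod (f z) < 1}"
proof (cases "E = {}")
  case True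
  then show ?thesis by (simp add: poly_convex_hull_def)
next
  case False
  have cf: "continuous_on S f" for S
    using f holomorphic_on_imp_continuous_on holomorphic_on_subset by blast
  obtain e where e: "e \<in> E" "\<And>z. z \<in> E \<Longrightarrow> cmod (f z) \<le> cmod (f e)"
    using continuous_attains_sup[OF E False, of "\<lambda>z. cmod (f z)"] cf continuous_on_norm by metis
  have "cmod (f z) < 1" if "z \<in> inside E" for z
  proof -
    have "cmod (f z) \<le> cmod (f e)"
    proof (rule maximum_modulus_frontier[of f "inside E"])
      show "bounded (inside E)" using E by (simp add: bounded_inside compact_imp_bounded)
      show "cmod (f z) \<le> cmod (f e)" if "z \<in> frontier (inside E)" for z
        using frontier_inside_subset[of E] E compact_imp_closed that e by blast
    qed (use f cf that in \<open>auto intro: holomorphic_on_subset\<close>)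
    then show ?thesis using less[OF e(1)] by simp
  qed
  moreover have "poly_convex_hull E = E \<union> inside E"
    by (simp add: poly_convex_hull_def union_with_inside)
  ultimately show ?thesis using less by auto
qed

section \<open>Weak limits of discrete measures in the plane\<close>

text \<open>Continuous with period 2. Clipping makes it constantly 0 where the cosine is at least
  1/2 and constantly 1 where it is at most -1/2, so digits are recovered exactly.\<close>

definition binary_wave :: "real \<Rightarrow> real" where
  "binary_wave x = max 0 (min 1 (1 / 2 - cos (pi * x)))"

lemma binary_wave_bounds: "0 \<le> binary_wave x" "binary_wave x \<le> 1"
  by (auto simp: binary_wave_def)

lemma continuous_on_binary_wave [continuous_intros]:
  fixes f :: "real \<Rightarrow> real"
  shows "continuous_on A f \<Longrightarrow> continuous_on A (\<lambda>x. binary_wave (f x))"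
  unfolding binary_wave_def by (intro continuous_intros)

lemma binary_wave_low:
  assumes "0 \<le> x" "x \<le> 1 / 3"
  shows "binary_wave (2 * real n + x) = 0"
proof -
  have "cos (pi * (2 * real n + x)) = cos (pi * x)"
    using cos_add[of "2 * real n * pi" "pi * x"] unfolding cos_2npi sin_2npi
    by (simp add: distrib_left mult_ac)
  moreover have "cos (pi / 3) \<le> cos (pi * x)"
    using assms by (intro cos_monotone_0_pi_le) (auto simp: field_simps)
  ultimately show ?thesis by (simp add: binary_wave_def cos_60)
qed

lemma binary_wave_high:
  assumes "2 / 3 \<le> x" "x \<le> 1"
  shows "binary_wave (2 * real n + x) = 1"
proof -
  have "cos (pi * (2 * real n + x)) = cos (pi * x)"
    using cos_add[of "2 * real n * pi" "pi * x"] unfolding cos_2npi sin_2npi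
    by (simp add: distrib_left mult_ac)
  moreover have "cos (pi * x) \<le> cos (2 * pi / 3)"
    using assms by (intro cos_monotone_0_pi_le) (auto simp: field_simps)
  moreover have "cos (2 * pi / 3) = - 1 / 2" by (simp add: cos_120)
  ultimately show ?thesis by (simp add: binary_wave_def)
qed

lemma binary_expansion:
  assumes "0 \<le> x" "x \<le> (1 :: real)"
  obtains b :: "nat \<Rightarrow> nat" where "\<And>k. b k \<le> 1" "(\<lambda>k. real (b k) * (1 / 2) ^ Suc k) sums x"
proof -
  \<comment> \<open>\<open>r k\<close> is the remainder after \<open>k\<close> digits, scaled by
    \<open>2 ^ k\<close>. It may equal 1, so \<open>x = 1\<close> is expanded with all digits
    1.\<close>
  define r where "r = rec_nat x (\<lambda>_ y. if y \<ge> 1 / 2 then 2 * y - 1 else 2 * y)"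
  define b where "b k = (if r k \<ge> 1 / 2 then 1 else 0 :: nat)" for k
  have r0: "r 0 = x" and rS: "r (Suc k) = 2 * r k - real (b k)" for k
    by (auto simp: r_def b_def)
  have r01: "0 \<le> r k \<and> r k \<le> 1" for k
    by (induction k) (use assms in \<open>auto simp: r0 rS b_def split: if_splits\<close>)
  have part: "(\<Sum>k<n. real (b k) * (1 / 2) ^ Suc k) = x - r n * (1 / 2) ^ n" for n
    by (induction n) (auto simp: r0 rS field_simps)
  have "(\<lambda>n. r n * (1 / 2) ^ n) \<longlonglongrightarrow> 0"
  proof (rule Lim_null_comparison)
    show "\<forall>\<^sub>F n in sequentially. norm (r n * (1 / 2) ^ n) \<le> (1 / 2) ^ n"
      using r01 by (intro always_eventually) (auto simp: abs_mult power_abs intro!: mult_left_le_one_le)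
    show "(\<lambda>n. (1 / 2 :: real) ^ n) \<longlonglongrightarrow> 0" by (rule LIMSEQ_power_zero) auto
  qed
  then have "(\<lambda>n. x - r n * (1 / 2) ^ n) \<longlonglongrightarrow> x - 0" by (intro tendsto_intros)
  then have "(\<lambda>k. real (b k) * (1 / 2) ^ Suc k) sums x"
    unfolding sums_def part by simp
  then show thesis using that[of b] by (auto simp: b_def)
qed

text \<open>Schoenberg's trick: the wave reads off the ternary digits of \<open>t\<close>, which are all 0 or 2.\<close>
lemma binary_wave_digits:
  fixes b :: "nat \<Rightarrow> nat"
  assumes b: "\<And>k. b k \<le> 1"
  obtains t where "0 \<le> t" "t \<le> 1" "\<And>k. binary_wave (3 ^ k * t) = real (b k)"
proof -
  \<comment> \<open>\<open>T k\<close> has the ternary digits \<open>2 * b k\<close>,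
    \<open>2 * b (k + 1)\<close> and so on; the required \<open>t\<close> is
    \<open>T 0\<close>.\<close>
  define T where "T k = (\<Sum>j. 2 * real (b (j + k)) * (1 / 3) ^ Suc j)" for k
  have geo: "(\<lambda>j. 2 * (1 / 3 :: real) ^ Suc j) sums 1"
    using sums_mult[OF geometric_sums[of "1 / 3 :: real"], of "2 / 3"] by simp
  have le: "2 * real (b (j + k)) * (1 / 3) ^ Suc j \<le> 2 * (1 / 3) ^ Suc j" for j k
    using b[of "j + k"] by simp
  have sm: "summable (\<lambda>j. 2 * real (b (j + k)) * (1 / 3) ^ Suc j)" for k
    by (rule summable_comparison_test'[OF sums_summable[OF geo], of 0]) (use le in auto)
  have T0: "0 \<le> T k" and T1: "T k \<le> 1" for k
  proof -
    show "0 \<le> T k" unfolding T_def by (intro suminf_nonneg sm) auto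
    show "T k \<le> 1" using suminf_le[OF le sm sums_summable[OF geo], of k] sums_unique[OF geo]
      by (simp add: T_def)
  qed
  have rec: "3 * T k = 2 * real (b k) + T (Suc k)" for k
  proof -
    have "T k = 2 * real (b k) / 3 + (\<Sum>j. 2 * real (b (Suc j + k)) * (1 / 3) ^ Suc (Suc j))"
      unfolding T_def using suminf_split_head[OF sm, of k] by simp
    also have "(\<Sum>j. 2 * real (b (Suc j + k)) * (1 / 3) ^ Suc (Suc j)) = 1 / 3 * T (Suc k)"
      unfolding T_def by (subst suminf_mult[OF sm, symmetric]) (simp add: mult_ac)
    finally show ?thesis by simp
  qed
  \<comment> \<open>All digits being even, multiplying by \<open>3 ^ k\<close> puts an even integer
    in front of \<open>T k\<close>, which the period 2 of the wave ignores.\<close>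
  have "\<exists>n. 3 ^ k * T 0 = 2 * real n + T k" for k
  proof (induction k)
    case 0
    show ?case by (intro exI[of _ 0]) simp
  next
    case (Suc k)
    then obtain n where "3 ^ k * T 0 = 2 * real n + T k" by blast
    then have "3 ^ Suc k * T 0 = 2 * real (3 * n + b k) + T (Suc k)"
      using rec[of k] by simp
    then show ?case by blast
  qed
  then obtain N where N: "\<And>k. 3 ^ k * T 0 = 2 * real (N k) + T k" by metis
  have "binary_wave (3 ^ k * T 0) = real (b k)" for k
  proof (cases "b k = 0")
    case True
    then show ?thesis unfolding N using rec[of k] T0[of k] T1[of "Suc k"]
      by (simp add: binary_wave_low)
  next
    case False
    then have "b k = 1" using b[of k] by simp
    then show ?thesis unfolding N using rec[of k] T1[of k] T0[of "Suc k"]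
      by (simp add: binary_wave_high)
  qed
  then show thesis using that T0 T1 by blast
qed

text \<open>The two coordinates read the even-numbered and the odd-numbered digits of one parameter,
  so interleaving the binary digits of \<open>x\<close> and \<open>y\<close> gives a preimage.
  Continuity comes from uniform convergence.\<close>

lemma square_filling_curve:
  obtains u v :: "real \<Rightarrow> real"
  where "continuous_on UNIV u" "continuous_on UNIV v"
    "\<And>t. 0 \<le> u t \<and> u t \<le> 1" "\<And>t. 0 \<le> v t \<and> v t \<le> 1"
    "\<And>x y. 0 \<le> x \<Longrightarrow> x \<le> 1 \<Longrightarrow> 0 \<le> y \<Longrightarrow> y \<le> 1 \<Longrightarrow> \<exists>t\<in>{0..1}. u t = x \<and> v t = y"
proof -
  define w where "w e t = (\<Sum>k. binary_wave (3 ^ (2 * k + e) * t) * (1 / 2) ^ Suc k)" for e :: nat and t :: real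
  have geo: "(\<lambda>k. (1 / 2 :: real) ^ Suc k) sums 1"
    using sums_mult[OF geometric_sums[of "1 / 2 :: real"], of "1 / 2"] by simp
  have le: "norm (binary_wave x * (1 / 2) ^ Suc k) \<le> (1 / 2) ^ Suc k" for x k
    using binary_wave_bounds[of x] by (auto simp: abs_mult power_abs intro!: mult_left_le_one_le)
  have cont: "continuous_on UNIV (w e)" for e
    unfolding w_def
  proof (rule uniform_limit_theorem)
    show "uniform_limit UNIV (\<lambda>n t. \<Sum>k<n. binary_wave (3 ^ (2 * k + e) * t) * (1 / 2) ^ Suc k)
        (\<lambda>t. \<Sum>k. binary_wave (3 ^ (2 * k + e) * t) * (1 / 2) ^ Suc k) sequentially"
      by (rule Weierstrass_m_test[OF le sums_summable[OF geo]])
  qed (auto intro!: always_eventually continuous_intros)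
  have sm: "summable (\<lambda>k. binary_wave (3 ^ (2 * k + e) * t) * (1 / 2) ^ Suc k)" for e t
    by (rule summable_comparison_test'[OF sums_summable[OF geo] le])
  have w01: "0 \<le> w e t \<and> w e t \<le> 1" for e t
  proof
    show "0 \<le> w e t" unfolding w_def
      by (intro suminf_nonneg sm mult_nonneg_nonneg binary_wave_bounds) auto
    have "w e t \<le> (\<Sum>k. (1 / 2) ^ Suc k)" unfolding w_def
      using le by (intro suminf_le sm sums_summable[OF geo]) (simp add: abs_le_iff)
    then show "w e t \<le> 1" using sums_unique[OF geo] by simp
  qed
  have "\<exists>t\<in>{0..1}. w 0 t = x \<and> w 1 t = y" if xy: "0 \<le> x" "x \<le> 1" "0 \<le> y" "y \<le> 1" for x y
  proof -
    obtain b where b: "\<And>k. b k \<le> 1" "(\<lambda>k. real (b k) * (1 / 2) ^ Suc k) sums x"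
      using binary_expansion[OF xy(1,2)] by blast
    obtain c where c: "\<And>k. c k \<le> 1" "(\<lambda>k. real (c k) * (1 / 2) ^ Suc k) sums y"
      using binary_expansion[OF xy(3,4)] by blast
    define d where "d k = (if even k then b (k div 2) else c (k div 2))" for k
    obtain t where t: "0 \<le> t" "t \<le> 1" "\<And>k. binary_wave (3 ^ k * t) = real (d k)"
      using binary_wave_digits[of d] b(1) c(1) by (metis d_def)
    have "w 0 t = x" "w 1 t = y"
      unfolding w_def t(3) using sums_unique[OF b(2)] sums_unique[OF c(2)] by (simp_all add: d_def)
    then show ?thesis using t by auto
  qed
  then show thesis using that[of "w 0" "w 1"] cont w01 by blast
qed

lemma plane_filling_curve:
  obtains h :: "real \<Rightarrow> complex"
  where "continuous_on UNIV h" "bounded (range h)" "\<And>z. cmod z \<le> R \<Longrightarrow> \<exists>t\<in>{0..1}. h t = z"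
proof -
  \<comment> \<open>The square of half-side \<open>S\<close> contains the disc; the added 1 keeps
    \<open>S\<close> positive for every \<open>R\<close>.\<close>
  define S where "S = \<bar>R\<bar> + 1"
  have S: "S > 0" by (simp add: S_def)
  obtain u v :: "real \<Rightarrow> real" where uv: "continuous_on UNIV u" "continuous_on UNIV v"
    "\<And>t. 0 \<le> u t \<and> u t \<le> 1" "\<And>t. 0 \<le> v t \<and> v t \<le> 1"
    "\<And>x y. 0 \<le> x \<Longrightarrow> x \<le> 1 \<Longrightarrow> 0 \<le> y \<Longrightarrow> y \<le> 1 \<Longrightarrow> \<exists>t\<in>{0..1}. u t = x \<and> v t = y"
    using square_filling_curve by blast
  define h where "h t = Complex (S * (2 * u t - 1)) (S * (2 * v t - 1))" for t
  have "continuous_on UNIV h"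
    unfolding h_def Complex_eq using uv(1,2) by (intro continuous_intros)
  moreover have "cmod (h t) \<le> S + S" for t
  proof -
    have "\<bar>S * (2 * u t - 1)\<bar> \<le> S" "\<bar>S * (2 * v t - 1)\<bar> \<le> S"
      using uv(3,4)[of t] S by (auto simp: abs_mult intro!: mult_left_le)
    then show ?thesis using cmod_le[of "h t"] by (simp add: h_def)
  qed
  then have "bounded (range h)" by (auto simp: bounded_iff)
  moreover have "\<exists>t\<in>{0..1}. h t = z" if "cmod z \<le> R" for z
  proof -
    have "\<bar>Re z\<bar> \<le> S" "\<bar>Im z\<bar> \<le> S"
      using that abs_Re_le_cmod[of z] abs_Im_le_cmod[of z] by (auto simp: S_def)
    then obtain t where "t \<in> {0..1}" "u t = (Re z / S + 1) / 2" "v t = (Im z / S + 1) / 2"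
      using uv(5)[of "(Re z / S + 1) / 2" "(Im z / S + 1) / 2"] S by (auto simp: field_simps abs_le_iff)
    then have "h t = z" "t \<in> {0..1}"
      using S by (simp_all add: h_def complex_eq_iff field_simps)
    then show ?thesis by blast
  qed
  ultimately show thesis using that by blast
qed

text \<open>The points are lifted to parameters in [0, 1] along a plane-filling curve
  \<open>h\<close>. Helly's selection theorem for measures on the line applies there, and the limit
  is pushed forward by \<open>h\<close>.\<close>

lemma weak_limit_of_averages:
  fixes z :: "nat \<Rightarrow> complex"
  assumes E: "compact E" and z: "\<And>i. z i \<in> E"
  obtains \<nu> s where "\<nu> \<in> prob_measures_on E" "strict_mono (s :: nat \<Rightarrow> nat)"
    "\<And>f :: complex \<Rightarrow> real. continuous_on UNIV f \<Longrightarrow>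
       (\<lambda>n. (\<Sum>i<s n. f (z i)) / real (s n)) \<longlonglongrightarrow> integral\<^sup>L \<nu> f"
proof -
  obtain R where R: "\<And>x. x \<in> E \<Longrightarrow> cmod x \<le> R"
    using compact_imp_bounded[OF E] by (auto simp: bounded_iff)
  obtain h :: "real \<Rightarrow> complex" where h: "continuous_on UNIV h" "bounded (range h)"
    "\<And>z. cmod z \<le> R \<Longrightarrow> \<exists>t\<in>{0..1}. h t = z"
    using plane_filling_curve[of R] by blast
  have "\<exists>t. t \<in> {0..1} \<and> h t = z i" for i using h(3)[OF R[OF z]] by blast
  then obtain t where t: "\<And>i. t i \<in> {0..1}" "\<And>i. h (t i) = z i" by metis
  \<comment> \<open>\<open>Suc n\<close> points, so that no average is empty.\<close>
  define \<mu> where "\<mu> n = distr (measure_pmf (pmf_of_set {..<Suc n})) borel t" for n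
  have int: "integral\<^sup>L (\<mu> n) f = (\<Sum>i<Suc n. f (t i)) / real (Suc n)"
    if "f \<in> borel_measurable borel" for f :: "real \<Rightarrow> real" and n
    unfolding \<mu>_def using that
    by (subst integral_distr, simp, simp, subst integral_pmf_of_set)
       (simp_all add: lessThan_empty_iff del: lessThan_Suc sum.lessThan_Suc)
  have rd: "real_distribution (\<mu> n)" for n
    unfolding \<mu>_def real_distribution_def real_distribution_axioms_def
    by (auto intro!: prob_space.prob_space_distr measure_pmf.prob_space_axioms)
  have "tight \<mu>"
    unfolding tight_def
  proof (intro conjI allI impI rd)
    fix \<epsilon> :: real assume e: "\<epsilon> > 0"
    have "measure (\<mu> n) {-1<..1} = 1" for n
    proof -
      interpret real_distribution "\<mu> n" by (rule rd)
      have "t i \<in> {-1<..1}" for i using t(1)[of i] by simp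
      then have "AE x in \<mu> n. x \<in> {-1<..1}" unfolding \<mu>_def
        by (subst AE_distr_iff) simp_all
      then show ?thesis by (subst prob_eq_1) auto
    qed
    then show "\<exists>a b. a < b \<and> (\<forall>n. 1 - \<epsilon> < measure (\<mu> n) {a<..b})"
      using e by (intro exI[of _ "-1"] exI[of _ 1]) auto
  qed
  then obtain r M where r: "strict_mono (r :: nat \<Rightarrow> nat)" and M: "real_distribution M"
    and conv: "weak_conv_m (\<mu> \<circ> id \<circ> r) M"
    using tight_imp_convergent_subsubsequence[of \<mu> id] strict_mono_id by blast
  interpret M: real_distribution M by (rule M)
  have hb[measurable]: "h \<in> borel_measurable borel"
    using h(1) by (rule borel_measurable_continuous_onI)
  define \<nu> where "\<nu> = distr M borel h"
  have lim: "(\<lambda>n. (\<Sum>i<Suc (r n). f (z i)) / real (Suc (r n))) \<longlonglongrightarrow> integral\<^sup>L \<nu> f"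
    if f: "continuous_on UNIV f" for f :: "complex \<Rightarrow> real"
  proof -
    have fb[measurable]: "f \<in> borel_measurable borel"
      using f by (rule borel_measurable_continuous_onI)
    \<comment> \<open>\<open>f\<close> itself may be unbounded; the bounded range of
      \<open>h\<close> makes the composition bounded, as weak convergence requires.\<close>
    have "compact (f ` closure (range h))"
      using h(2) by (intro compact_continuous_image continuous_on_subset[OF f]) auto
    then have "bounded (range (\<lambda>x. f (h x)))"
      by (rule bounded_subset[OF compact_imp_bounded]) (use closure_subset[of "range h"] in auto)
    then obtain B where B: "\<And>x. norm (f (h x)) \<le> B" unfolding bounded_iff by blast
    have "continuous_on UNIV (\<lambda>x. f (h x))"
      using continuous_on_compose[OF h(1) continuous_on_subset[OF f]] by (simp add: o_def)
    then have "isCont (\<lambda>x. f (h x)) x" for x by (simp add: continuous_on_eq_continuous_at)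
    then have "(\<lambda>n. integral\<^sup>L ((\<mu> \<circ> id \<circ> r) n) (\<lambda>x. f (h x))) \<longlonglongrightarrow> integral\<^sup>L M (\<lambda>x. f (h x))"
      using B by (intro weak_conv_imp_integral_bdd_continuous_conv[OF _ M conv]) (simp_all add: rd)
    then show ?thesis
      by (simp add: int t(2) \<nu>_def integral_distr del: sum.lessThan_Suc of_nat_Suc)
  qed
  have pv: "prob_space \<nu>" unfolding \<nu>_def by (rule M.prob_space_distr) simp
  then interpret \<nu>: prob_space \<nu> .
  have sets: "sets \<nu> = sets borel" by (simp add: \<nu>_def)
  \<comment> \<open>This bounded test function vanishes at every \<open>z i\<close>, so its integral
    in the limit is 0; it is positive off the closed set \<open>E\<close>.\<close>
  define g where "g x = min 1 (infdist x E)" for x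
  have gc: "continuous_on UNIV g" unfolding g_def by (intro continuous_intros)
  have gb: "g \<in> borel_measurable borel" using gc by (rule borel_measurable_continuous_onI)
  have "(\<lambda>n. (\<Sum>i<Suc (r n). g (z i)) / real (Suc (r n))) \<longlonglongrightarrow> integral\<^sup>L \<nu> g" by (rule lim[OF gc])
  moreover have "g (z i) = 0" for i using z by (simp add: g_def)
  ultimately have int0: "integral\<^sup>L \<nu> g = 0" by (simp add: LIMSEQ_const_iff)
  have "g \<in> borel_measurable \<nu>" using gb measurable_cong_sets[OF sets refl] by blast
  then have "integrable \<nu> g"
    by (intro \<nu>.integrable_const_bound[of _ 1] AE_I2) (auto simp: g_def infdist_nonneg)
  then have "AE x in \<nu>. g x = 0"
    using int0 by (subst (asm) integral_nonneg_eq_0_iff_AE) (auto simp: g_def infdist_nonneg)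
  then have "AE x in \<nu>. x \<in> E"
  proof eventually_elim
    case (elim x)
    then have "infdist x E = 0" by (auto simp: g_def min_def split: if_splits)
    then show ?case using in_closed_iff_infdist_zero[of E x] z compact_imp_closed[OF E] by blast
  qed
  then have "emeasure \<nu> E = 1"
    using \<nu>.emeasure_eq_1_AE[of E] compact_imp_closed[OF E] by (simp add: sets)
  then have "\<nu> \<in> prob_measures_on E" using pv sets by (simp add: prob_measures_on_def)
  moreover have "strict_mono (\<lambda>n. Suc (r n))" using r by (simp add: strict_mono_def)
  ultimately show thesis using that lim by blast
qed

section \<open>Energy\<close>

text \<open>This is \<open>log_kernel\<close> plus \<open>ln R\<close>. When \<open>R\<close> bounds
  the distances in \<open>E\<close>, it is nonnegative there, and an energy is a single
  \<open>ennreal\<close> integral.\<close>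

definition shifted_kernel :: "real \<Rightarrow> complex \<Rightarrow> complex \<Rightarrow> ennreal" where
  "shifted_kernel R z w = (if z = w then \<infinity> else ennreal (ln (R / cmod (z - w))))"

definition shifted_energy :: "real \<Rightarrow> complex measure \<Rightarrow> ennreal" where
  "shifted_energy R \<nu> = (\<integral>\<^sup>+ w. (\<integral>\<^sup>+ z. shifted_kernel R z w \<partial>\<nu>) \<partial>\<nu>)"

lemma shifted_kernel_commute: "shifted_kernel R z w = shifted_kernel R w z"
  by (simp add: shifted_kernel_def norm_minus_commute)

lemma shifted_kernel_measurable [measurable]:
  "(\<lambda>x. shifted_kernel R (fst x) (snd x)) \<in> borel_measurable (borel \<Otimes>\<^sub>M borel)"
proof -
  have "shifted_kernel R z w = (if cmod (z - w) = 0 then \<infinity> else ennreal (ln (R / cmod (z - w))))" for z w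
    by (simp add: shifted_kernel_def)
  then show ?thesis by simp
qed

lemma log_kernel_measurable [measurable]:
  "(\<lambda>x. log_kernel (fst x) (snd x)) \<in> borel_measurable (borel \<Otimes>\<^sub>M borel)"
proof -
  have "log_kernel z w = (if cmod (z - w) = 0 then \<infinity> else ereal (ln (1 / cmod (z - w))))" for z w
    by (simp add: log_kernel_def)
  then show ?thesis by simp
qed

lemma prob_measures_onD:
  assumes "\<nu> \<in> prob_measures_on E"
  shows "prob_space \<nu>" "sets \<nu> = sets borel" "AE z in \<nu>. z \<in> E"
proof -
  show p: "prob_space \<nu>" and "sets \<nu> = sets borel"
    using assms by (auto simp: prob_measures_on_def)
  interpret prob_space \<nu> by (rule p)
  have "prob E = 1" using assms by (simp add: prob_measures_on_def measure_def)
  then show "AE z in \<nu>. z \<in> E" by (rule AE_prob_1)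
qed

context
  fixes E :: "complex set" and \<nu> :: "complex measure" and R :: real
  assumes \<nu>: "\<nu> \<in> prob_measures_on E"
    and R: "R \<ge> 1" "\<And>z w. z \<in> E \<Longrightarrow> w \<in> E \<Longrightarrow> cmod (z - w) \<le> R"
begin

interpretation prob_space \<nu> by (rule prob_measures_onD[OF \<nu>])

lemma section_measurable:
  assumes f: "(\<lambda>x. f (fst x) (snd x)) \<in> borel_measurable (borel \<Otimes>\<^sub>M borel)"
  shows "(\<lambda>z. f z w) \<in> borel_measurable \<nu>" "(\<lambda>w. f z w) \<in> borel_measurable \<nu>"
  using measurable_compose[OF _ f, of "\<lambda>z. (z, w)" borel] measurable_compose[OF _ f, of "\<lambda>w. (z, w)" borel]
    measurable_cong_sets[OF prob_measures_onD(2)[OF \<nu>] refl] by auto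

lemma partial_integral_measurable:
  fixes f :: "complex \<Rightarrow> complex \<Rightarrow> ennreal"
  assumes f: "(\<lambda>x. f (fst x) (snd x)) \<in> borel_measurable (borel \<Otimes>\<^sub>M borel)"
  shows "(\<lambda>w. \<integral>\<^sup>+ z. f z w \<partial>\<nu>) \<in> borel_measurable \<nu>"
proof -
  have "(\<lambda>x. f (snd x) (fst x)) \<in> borel_measurable (borel \<Otimes>\<^sub>M borel)"
    using measurable_compose[OF _ f, of "\<lambda>x. (snd x, fst x)" "borel \<Otimes>\<^sub>M borel"] by simp
  then have "(\<lambda>x. f (snd x) (fst x)) \<in> borel_measurable (\<nu> \<Otimes>\<^sub>M \<nu>)"
    using measurable_cong_sets[OF sets_pair_measure_cong[OF prob_measures_onD(2)[OF \<nu>] prob_measures_onD(2)[OF \<nu>]] refl]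
    by blast
  then show ?thesis by (intro borel_measurable_nn_integral) (simp add: split_def)
qed

text \<open>Off the diagonal, \<open>max x 0 + ln R = (x + ln R) + max (- x) 0\<close>; on it both
  sides are infinite. The identity is additive because the positive part may be infinite.\<close>

lemma log_energy_shift:
  "(\<integral>\<^sup>+ w. (\<integral>\<^sup>+ z. e2ennreal (log_kernel z w) \<partial>\<nu>) \<partial>\<nu>) + ennreal (ln R)
    = shifted_energy R \<nu> + (\<integral>\<^sup>+ w. (\<integral>\<^sup>+ z. e2ennreal (- log_kernel z w) \<partial>\<nu>) \<partial>\<nu>)" (is "?P + _ = _ + ?N")
  and log_energy_negative_part:
  "(\<integral>\<^sup>+ w. (\<integral>\<^sup>+ z. e2ennreal (- log_kernel z w) \<partial>\<nu>) \<partial>\<nu>) \<le> ennreal (ln R)"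
proof -
  have lnR: "ln R \<ge> 0" using R(1) by simp
  have pos: "(\<lambda>x. e2ennreal (log_kernel (fst x) (snd x))) \<in> borel_measurable (borel \<Otimes>\<^sub>M borel)"
    and neg: "(\<lambda>x. e2ennreal (- log_kernel (fst x) (snd x))) \<in> borel_measurable (borel \<Otimes>\<^sub>M borel)"
    by measurable
  have ptw: "e2ennreal (log_kernel z w) + ennreal (ln R) = shifted_kernel R z w + e2ennreal (- log_kernel z w)"
    and le: "e2ennreal (- log_kernel z w) \<le> ennreal (ln R)" if "z \<in> E" "w \<in> E" for z w
  proof -
    show "e2ennreal (log_kernel z w) + ennreal (ln R) = shifted_kernel R z w + e2ennreal (- log_kernel z w)"
    proof (cases "z = w")
      case True
      then show ?thesis by (simp add: log_kernel_def shifted_kernel_def)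
    next
      case False
      define x where "x = ln (1 / cmod (z - w))"
      have x: "ln (R / cmod (z - w)) = x + ln R"
        using False R(1) by (simp add: x_def ln_div)
      have "x + ln R \<ge> 0" unfolding x[symmetric] using False R(2)[OF that] by (simp add: field_simps)
      then have "ennreal x + ennreal (ln R) = ennreal (x + ln R) + ennreal (- x)"
        using lnR by (cases "x \<ge> 0") (simp_all add: ennreal_neg flip: ennreal_plus)
      then show ?thesis using False
        by (simp add: log_kernel_def shifted_kernel_def e2ennreal_ereal x x_def[symmetric])
    qed
    show "e2ennreal (- log_kernel z w) \<le> ennreal (ln R)"
    proof (cases "z = w")
      case True
      then show ?thesis by (simp add: log_kernel_def e2ennreal_neg)
    next
      case False
      then have "- ln (1 / cmod (z - w)) \<le> ln R"
        using R(2)[OF that] R(1) by (simp add: ln_div)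
      then show ?thesis using False by (simp add: log_kernel_def e2ennreal_ereal ennreal_leI)
    qed
  qed
  note AE = prob_measures_onD(3)[OF \<nu>]
  have "?P + ennreal (ln R) = (\<integral>\<^sup>+ w. (\<integral>\<^sup>+ z. e2ennreal (log_kernel z w) \<partial>\<nu>) + ennreal (ln R) \<partial>\<nu>)"
    by (subst nn_integral_add[OF partial_integral_measurable[OF pos]]) (auto simp: emeasure_space_1)
  also have "\<dots> = (\<integral>\<^sup>+ w. (\<integral>\<^sup>+ z. e2ennreal (log_kernel z w) + ennreal (ln R) \<partial>\<nu>) \<partial>\<nu>)"
    by (subst nn_integral_add[OF section_measurable(1)[OF pos]]) (auto simp: emeasure_space_1)
  also have "\<dots> = (\<integral>\<^sup>+ w. (\<integral>\<^sup>+ z. shifted_kernel R z w + e2ennreal (- log_kernel z w) \<partial>\<nu>) \<partial>\<nu>)"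
    using AE
  proof (intro nn_integral_cong_AE, eventually_elim)
    case (elim w)
    show ?case by (intro nn_integral_cong_AE, use AE in eventually_elim) (use elim ptw in auto)
  qed
  also have "\<dots> = (\<integral>\<^sup>+ w. (\<integral>\<^sup>+ z. shifted_kernel R z w \<partial>\<nu>) + (\<integral>\<^sup>+ z. e2ennreal (- log_kernel z w) \<partial>\<nu>) \<partial>\<nu>)"
    by (subst nn_integral_add[OF section_measurable(1)[OF shifted_kernel_measurable] section_measurable(1)[OF neg]]) simp
  also have "\<dots> = shifted_energy R \<nu> + ?N" unfolding shifted_energy_def
    by (subst nn_integral_add[OF partial_integral_measurable[OF shifted_kernel_measurable]
          partial_integral_measurable[OF neg]]) simp
  finally show "?P + ennreal (ln R) = shifted_energy R \<nu> + ?N" .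
  have "?N \<le> (\<integral>\<^sup>+ w. (\<integral>\<^sup>+ z. ennreal (ln R) \<partial>\<nu>) \<partial>\<nu>)" using AE
  proof (intro nn_integral_mono_AE, eventually_elim)
    case (elim w)
    show ?case by (intro nn_integral_mono_AE, use AE in eventually_elim) (use elim le in auto)
  qed
  then show "?N \<le> ennreal (ln R)" by (simp add: emeasure_space_1)
qed

text \<open>The assumption and the bounded negative part force all terms of
  \<open>log_energy_shift\<close> to be finite, so it can be solved for the shifted energy.\<close>

lemma shifted_energy_le:
  assumes "log_energy \<nu> < ereal \<epsilon>" "\<epsilon> \<ge> 0"
  shows "shifted_energy R \<nu> \<le> ennreal (ln R + \<epsilon>)"
proof -
  define P where "P = (\<integral>\<^sup>+ w. (\<integral>\<^sup>+ z. e2ennreal (log_kernel z w) \<partial>\<nu>) \<partial>\<nu>)"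
  define N where "N = (\<integral>\<^sup>+ w. (\<integral>\<^sup>+ z. e2ennreal (- log_kernel z w) \<partial>\<nu>) \<partial>\<nu>)"
  have eq: "P + ennreal (ln R) = shifted_energy R \<nu> + N" and N: "N \<le> ennreal (ln R)"
    using log_energy_shift log_energy_negative_part by (simp_all add: P_def N_def)
  have less: "enn2ereal P - enn2ereal N < ereal \<epsilon>"
    using assms by (simp add: log_energy_def P_def N_def)
  obtain n where n: "N = ennreal n" "n \<ge> 0" using N by (cases N) (auto simp: top_unique)
  obtain p where p: "P = ennreal p" "p \<ge> 0" using less n by (cases P) auto
  have "p - n < \<epsilon>" using less n p by (simp add: enn2ereal_ennreal)
  moreover obtain b where b: "shifted_energy R \<nu> = ennreal b" "b \<ge> 0"
    using eq n p by (cases "shifted_energy R \<nu>") auto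
  moreover have "p + ln R = b + n"
    using eq n p b R(1) by (simp flip: ennreal_plus)
  ultimately show ?thesis by (simp add: ennreal_leI)
qed

text \<open>The finite \<open>ln R\<close> cancels, so the positive part is at most the negative
  part, which is finite.\<close>

lemma log_energy_le_0:
  assumes "shifted_energy R \<nu> \<le> ennreal (ln R)"
  shows "log_energy \<nu> \<le> 0"
proof -
  define P where "P = (\<integral>\<^sup>+ w. (\<integral>\<^sup>+ z. e2ennreal (log_kernel z w) \<partial>\<nu>) \<partial>\<nu>)"
  define N where "N = (\<integral>\<^sup>+ w. (\<integral>\<^sup>+ z. e2ennreal (- log_kernel z w) \<partial>\<nu>) \<partial>\<nu>)"
  have "P + ennreal (ln R) = shifted_energy R \<nu> + N"
    using log_energy_shift by (simp add: P_def N_def)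
  also have "\<dots> \<le> N + ennreal (ln R)" using assms by (simp add: add.commute add_left_mono)
  finally have "P \<le> N" by (simp add: add.commute ennreal_add_left_cancel_le)
  moreover have "N \<noteq> \<top>" using log_energy_negative_part by (auto simp: N_def top_unique)
  ultimately show ?thesis
    unfolding log_energy_def P_def[symmetric] N_def[symmetric]
    by (simp add: ereal_minus_le_iff less_eq_ennreal.rep_eq)
qed

text \<open>Choosing the points one at a time, each time not exceeding the average over the point to be
  chosen of the expected final energy when the remaining points are drawn from \<open>\<nu>\<close>.\<close>
lemma discrete_energy_le:
  assumes fin: "shifted_energy R \<nu> < \<infinity>"
  obtains S where "finite S" "S \<subseteq> E" "card S = n"
    "(\<Sum>x\<in>S. \<Sum>y\<in>S - {x}. shifted_kernel R x y) \<le> of_nat (n * (n - 1)) * shifted_energy R \<nu>"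
proof -
  define B where "B = shifted_energy R \<nu>"
  define p where "p x = (\<integral>\<^sup>+ z. shifted_kernel R z x \<partial>\<nu>)" for x
  have pm: "p \<in> borel_measurable \<nu>" unfolding p_def
    by (rule partial_integral_measurable[OF shifted_kernel_measurable])
  have km: "shifted_kernel R y \<in> borel_measurable \<nu>" for y
    using section_measurable(2)[OF shifted_kernel_measurable, of R y] by simp
  have intp: "(\<integral>\<^sup>+ x. p x \<partial>\<nu>) = B" by (simp add: p_def B_def shifted_energy_def)
  have intk: "(\<integral>\<^sup>+ x. shifted_kernel R y x \<partial>\<nu>) = p y" for y
    by (simp add: p_def shifted_kernel_commute)
  \<comment> \<open>Expected energy over ordered pairs when \<open>S\<close> is fixed and
    \<open>j\<close> further points are drawn independently from \<open>\<nu>\<close>: pairs inside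
    \<open>S\<close>, mixed pairs, and pairs of random points.\<close>
  define \<Phi> where "\<Phi> j S = (\<Sum>x\<in>S. \<Sum>y\<in>S - {x}. shifted_kernel R x y)
    + 2 * of_nat j * (\<Sum>x\<in>S. p x) + of_nat (j * (j - 1)) * B" for j S
  have "\<exists>S. finite S \<and> S \<subseteq> E \<and> card S = m \<and> \<Phi> (n - m) S \<le> of_nat (n * (n - 1)) * B" if "m \<le> n" for m
    using that
  proof (induction m)
    case 0
    then show ?case by (intro exI[of _ "{}"]) (simp add: \<Phi>_def)
  next
    case (Suc m)
    then obtain S where S: "finite S" "S \<subseteq> E" "card S = m" "\<Phi> (n - m) S \<le> of_nat (n * (n - 1)) * B"
      by auto
    define j where "j = n - Suc m"
    have nm: "n - m = Suc j" using Suc.prems by (simp add: j_def)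
    \<comment> \<open>The share of a new point \<open>x\<close>: its pairs with \<open>S\<close> and
      with the \<open>j\<close> points still to be drawn, in both orders.\<close>
    define f where "f x = 2 * (\<Sum>y\<in>S. shifted_kernel R y x) + 2 * of_nat j * p x" for x
    have fm: "f \<in> borel_measurable \<nu>" unfolding f_def
      by (intro borel_measurable_add borel_measurable_times_ennreal borel_measurable_sum pm km) auto
    have "(\<integral>\<^sup>+ x. f x \<partial>\<nu>) = (\<integral>\<^sup>+ x. 2 * (\<Sum>y\<in>S. shifted_kernel R y x) \<partial>\<nu>) + (\<integral>\<^sup>+ x. 2 * of_nat j * p x \<partial>\<nu>)"
      unfolding f_def
      by (intro nn_integral_add borel_measurable_times_ennreal borel_measurable_sum pm km) auto
    also have "\<dots> = 2 * (\<Sum>y\<in>S. p y) + 2 * of_nat j * B"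
      by (simp add: nn_integral_cmult pm km borel_measurable_sum nn_integral_sum intp intk)
    finally have intf: "(\<integral>\<^sup>+ x. f x \<partial>\<nu>) = 2 * (\<Sum>y\<in>S. p y) + 2 * of_nat j * B" .
    \<comment> \<open>The mean of \<open>f\<close> must be finite, both for the strict comparison
      below and to keep \<open>x\<close> out of \<open>S\<close>.\<close>
    have "of_nat (Suc j) * (\<Sum>x\<in>S. p x) < \<infinity>"
    proof -
      have "2 * of_nat (Suc j) * (\<Sum>x\<in>S. p x) \<le> \<Phi> (n - m) S"
        unfolding \<Phi>_def nm by (meson add_increasing add_increasing2 order_refl zero_le)
      also have "\<dots> < \<infinity>" using S(4) fin B_def
        by (metis ennreal_mult_less_top infinity_ennreal_def of_nat_less_top order_le_less_trans)
      finally show ?thesis by (auto simp: ennreal_mult_less_top mult.assoc of_nat_less_top simp del: of_nat_Suc)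
    qed
    then have "(\<Sum>x\<in>S. p x) < \<infinity>" by (auto simp: ennreal_mult_less_top simp del: of_nat_Suc)
    then have fin': "(\<integral>\<^sup>+ x. f x \<partial>\<nu>) < \<infinity>" unfolding intf using fin
      by (simp add: ennreal_mult_less_top of_nat_less_top B_def)
    \<comment> \<open>If \<open>f\<close> exceeded its mean on all of \<open>E\<close>, it would do
      so almost everywhere, and its integral would exceed itself.\<close>
    have "\<exists>x\<in>E. f x \<le> (\<integral>\<^sup>+ x. f x \<partial>\<nu>)"
    proof (rule ccontr)
      define c where "c = (\<integral>\<^sup>+ x. f x \<partial>\<nu>)"
      assume "\<not> ?thesis"
      then have gt: "f x > c" if "x \<in> E" for x using that by (force simp: not_le c_def)
      have "(\<integral>\<^sup>+ x. c \<partial>\<nu>) < (\<integral>\<^sup>+ x. f x \<partial>\<nu>)"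
      proof (rule nn_integral_less)
        show "(\<integral>\<^sup>+ x. c \<partial>\<nu>) \<noteq> \<infinity>" using fin' by (simp add: c_def emeasure_space_1)
        show "AE x in \<nu>. c \<le> f x" using prob_measures_onD(3)[OF \<nu>] by eventually_elim (use gt in force)
        show "\<not> (AE x in \<nu>. f x \<le> c)"
        proof
          assume "AE x in \<nu>. f x \<le> c"
          with prob_measures_onD(3)[OF \<nu>] have "AE x in \<nu>. False"
            by eventually_elim (use gt in force)
          then show False by simp
        qed
      qed (auto intro: fm)
      then show False by (simp add: emeasure_space_1 c_def)
    qed
    then obtain x where x: "x \<in> E" "f x \<le> (\<integral>\<^sup>+ x. f x \<partial>\<nu>)" by blast
    \<comment> \<open>The infinite diagonal of the kernel forces the new point to be distinct from
      the old ones.\<close>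
    have "x \<notin> S"
    proof
      assume xS: "x \<in> S"
      have "(\<Sum>y\<in>S. shifted_kernel R y x) = \<infinity>"
        using xS S(1) by (subst sum.remove[of _ x]) (auto simp: shifted_kernel_def)
      then have "f x = \<infinity>" by (simp add: f_def ennreal_mult_top)
      then show False using x(2) fin' by simp
    qed
    have pairs: "(\<Sum>u\<in>insert x S. \<Sum>y\<in>insert x S - {u}. shifted_kernel R u y)
      = (\<Sum>u\<in>S. \<Sum>y\<in>S - {u}. shifted_kernel R u y) + 2 * (\<Sum>y\<in>S. shifted_kernel R y x)"
    proof -
      have "insert x S - {u} = insert x (S - {u})" if "u \<in> S" for u using \<open>x \<notin> S\<close> that by auto
      then have "(\<Sum>u\<in>S. \<Sum>y\<in>insert x S - {u}. shifted_kernel R u y)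
        = (\<Sum>u\<in>S. shifted_kernel R u x + (\<Sum>y\<in>S - {u}. shifted_kernel R u y))"
        using S(1) \<open>x \<notin> S\<close> by (intro sum.cong) auto
      moreover have "insert x S - {x} = S" using \<open>x \<notin> S\<close> by auto
      ultimately show ?thesis using S(1) \<open>x \<notin> S\<close>
        by (simp add: sum.distrib shifted_kernel_commute[of R x] mult_2 add_ac)
    qed
    have "\<Phi> j (insert x S) = (\<Sum>u\<in>S. \<Sum>y\<in>S - {u}. shifted_kernel R u y) + f x
        + 2 * of_nat j * (\<Sum>x\<in>S. p x) + of_nat (j * (j - 1)) * B"
      unfolding \<Phi>_def pairs f_def using S(1) \<open>x \<notin> S\<close> by (simp add: distrib_left add_ac)
    also have "\<dots> \<le> (\<Sum>u\<in>S. \<Sum>y\<in>S - {u}. shifted_kernel R u y) + (2 * (\<Sum>y\<in>S. p y) + 2 * of_nat j * B)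
        + 2 * of_nat j * (\<Sum>x\<in>S. p x) + of_nat (j * (j - 1)) * B"
      using x(2) unfolding intf by (intro add_mono order_refl)
    also have "\<dots> = \<Phi> (Suc j) S"
    proof -
      have "of_nat (Suc j * (Suc j - 1)) * B = 2 * of_nat j * B + of_nat (j * (j - 1)) * B"
      proof -
        have "Suc j * (Suc j - 1) = 2 * j + j * (j - 1)" by (cases j) auto
        then show ?thesis by (simp only: of_nat_add of_nat_mult distrib_right of_nat_numeral)
      qed
      then show ?thesis unfolding \<Phi>_def by (simp add: distrib_left distrib_right add_ac)
    qed
    finally have "\<Phi> j (insert x S) \<le> of_nat (n * (n - 1)) * B" using S(4) unfolding nm by simp
    then show ?case using S x \<open>x \<notin> S\<close> by (intro exI[of _ "insert x S"]) (auto simp: j_def)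
  qed
  from this[of n] obtain S where "finite S" "S \<subseteq> E" "card S = n" "\<Phi> 0 S \<le> of_nat (n * (n - 1)) * B"
    by auto
  then show thesis using that[of S] by (simp add: \<Phi>_def B_def)
qed

end

section \<open>Truncated kernels and the energy of Leja sequences\<close>

text \<open>Finite and continuous across the diagonal, so weak convergence applies to it; it
  increases to the shifted kernel as \<open>\<delta>\<close> decreases to 0.\<close>

definition truncated_kernel :: "real \<Rightarrow> real \<Rightarrow> complex \<Rightarrow> complex \<Rightarrow> real" where
  "truncated_kernel R \<delta> z w = ln (R / max (cmod (z - w)) \<delta>)"

lemma truncated_kernel_commute: "truncated_kernel R \<delta> z w = truncated_kernel R \<delta> w z"
  by (simp add: truncated_kernel_def norm_minus_commute)

lemma abs_ln_diff_le:
  fixes u v d :: real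
  assumes "0 < d" "d \<le> u" "d \<le> v"
  shows "\<bar>ln u - ln v\<bar> \<le> \<bar>u - v\<bar> / d"
proof -
  have *: "ln u - ln v \<le> \<bar>u - v\<bar> / d" if "d \<le> u" "d \<le> v" for u v
  proof -
    have "ln u - ln v = ln (u / v)" using that assms(1) by (simp add: ln_div)
    also have "\<dots> \<le> u / v - 1" using that assms(1) by (intro ln_le_minus_one) auto
    also have "\<dots> = (u - v) / v" using that assms(1) by (simp add: field_simps)
    also have "\<dots> \<le> \<bar>u - v\<bar> / d" using that assms(1) by (intro frac_le) auto
    finally show ?thesis .
  qed
  from *[OF assms(2,3)] *[OF assms(3,2)] show ?thesis by (simp add: abs_minus_commute abs_le_iff)
qed

text \<open>Taking the maximum with \<open>\<delta>\<close> is 1-Lipschitz, and \<open>ln\<close> is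
  Lipschitz with constant \<open>1 / \<delta>\<close> above \<open>\<delta>\<close>. The constant is
  independent of \<open>z\<close>, so averages over \<open>z\<close> share it.\<close>

lemma truncated_kernel_lipschitz:
  assumes "0 < \<delta>" "R > 0"
  shows "\<bar>truncated_kernel R \<delta> z w - truncated_kernel R \<delta> z w'\<bar> \<le> cmod (w - w') / \<delta>"
proof -
  have pos: "max (cmod (z - w)) \<delta> > 0" "max (cmod (z - w')) \<delta> > 0" using assms by auto
  have "\<bar>truncated_kernel R \<delta> z w - truncated_kernel R \<delta> z w'\<bar>
      = \<bar>ln (max (cmod (z - w')) \<delta>) - ln (max (cmod (z - w)) \<delta>)\<bar>"
    unfolding truncated_kernel_def using pos assms(2) by (simp add: ln_div)
  also have "\<dots> \<le> \<bar>max (cmod (z - w')) \<delta> - max (cmod (z - w)) \<delta>\<bar> / \<delta>"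
    using assms by (intro abs_ln_diff_le) auto
  also have "\<bar>max (cmod (z - w')) \<delta> - max (cmod (z - w)) \<delta>\<bar> \<le> \<bar>cmod (z - w') - cmod (z - w)\<bar>"
    by (auto simp: max_def)
  also have "\<dots> \<le> cmod (w - w')"
    using norm_triangle_ineq3[of "z - w'" "z - w"] by simp
  finally show ?thesis using assms by (simp add: divide_right_mono)
qed

lemma continuous_truncated_kernel:
  assumes "0 < \<delta>" "R > 0"
  shows "continuous_on UNIV (\<lambda>z. truncated_kernel R \<delta> z w)"
  unfolding truncated_kernel_def
proof (intro continuous_intros ballI)
  fix z
  have pos: "max (cmod (z - w)) \<delta> > 0" using assms by (simp add: less_max_iff_disj)
  then show "max (cmod (z - w)) \<delta> \<noteq> 0" by linarith
  show "R / max (cmod (z - w)) \<delta> \<noteq> 0" using divide_pos_pos[OF assms(2) pos] by linarith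
qed

text \<open>The point \<open>z n\<close> adds one diagonal term \<open>ln (R / \<delta>)\<close> and
  twice a row of sum at most \<open>n * ln R\<close>: its distances to the earlier points have
  product at least 1, and truncation only lowers the kernel.\<close>

lemma sum_truncated_kernel_le:
  fixes z :: "nat \<Rightarrow> complex"
  assumes d: "0 < \<delta>" and R: "R \<ge> 1" and z: "\<And>n. (\<Prod>i<n. cmod (z n - z i)) \<ge> 1"
  shows "(\<Sum>j<n. \<Sum>i<n. truncated_kernel R \<delta> (z i) (z j)) \<le> n * ln (R / \<delta>) + real n * real n * ln R"
proof (induction n)
  case (Suc n)
  let ?k = "\<lambda>i j. truncated_kernel R \<delta> (z i) (z j)"
  have nz: "cmod (z n - z i) > 0" if "i < n" for i
  proof (rule ccontr)
    assume "\<not> ?thesis"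
    then have "\<exists>i\<in>{..<n}. cmod (z n - z i) = 0" using that by (intro bexI[of _ i]) simp_all
    then have "(\<Prod>i<n. cmod (z n - z i)) = 0" by (intro prod_zero finite_lessThan)
    then show False using z[of n] by linarith
  qed
  have "(\<Sum>i<n. ?k i n) \<le> (\<Sum>i<n. ln R - ln (cmod (z n - z i)))"
  proof (rule sum_mono)
    fix i assume "i \<in> {..<n}"
    then have "0 < cmod (z n - z i)" using nz by simp
    moreover have "?k i n \<le> ln (R / cmod (z n - z i))"
      unfolding truncated_kernel_def using calculation R d
      by (intro ln_mono divide_left_mono divide_pos_pos mult_pos_pos) (auto simp: norm_minus_commute)
    ultimately show "?k i n \<le> ln R - ln (cmod (z n - z i))" using R by (simp add: ln_div)
  qed
  also have "\<dots> = n * ln R - ln (\<Prod>i<n. cmod (z n - z i))"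
    using nz by (subst ln_prod) (auto simp: sum_subtractf)
  also have "\<dots> \<le> n * ln R" using ln_mono[OF z[of n]] by simp
  finally have 1: "(\<Sum>i<n. ?k i n) \<le> n * ln R" .
  have 2: "?k n n = ln (R / \<delta>)" using d by (simp add: truncated_kernel_def)
  have 3: "(\<Sum>j<n. ?k n j) = (\<Sum>i<n. ?k i n)" by (rule sum.cong[OF refl truncated_kernel_commute])
  have "(\<Sum>j<Suc n. \<Sum>i<Suc n. ?k i j) = (\<Sum>j<n. \<Sum>i<n. ?k i j) + 2 * (\<Sum>i<n. ?k i n) + ?k n n"
    by (simp add: sum.distrib 3)
  also have "\<dots> \<le> (n * ln (R / \<delta>) + real n * real n * ln R) + 2 * (n * ln R) + ln (R / \<delta>)"
    using Suc.IH 1 2 by linarith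
  also have "\<dots> \<le> Suc n * ln (R / \<delta>) + real (Suc n) * real (Suc n) * ln R"
    using R by (simp add: algebra_simps)
  finally show ?case .
qed simp

text \<open>The measure is a weak limit of averages of point masses at the \<open>z i\<close>. For
  fixed \<open>\<delta>\<close> the diagonal terms vanish in the limit, leaving truncated energy at
  most \<open>ln R\<close>; then \<open>\<delta>\<close> tends to 0.\<close>

lemma leja_sequence_energy:
  fixes z :: "nat \<Rightarrow> complex"
  assumes E: "compact E" and zE: "\<And>n. z n \<in> E" and z: "\<And>n. (\<Prod>i<n. cmod (z n - z i)) \<ge> 1"
  shows "\<exists>\<nu>\<in>prob_measures_on E. log_energy \<nu> \<le> 0"
proof -
  obtain b where b: "\<And>x. x \<in> E \<Longrightarrow> cmod x \<le> b"
    using compact_imp_bounded[OF E] by (auto simp: bounded_iff)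
  \<comment> \<open>A bound for the distances in \<open>E\<close>; the added 1 makes
    \<open>ln R\<close> nonnegative.\<close>
  define R where "R = 2 * \<bar>b\<bar> + 1"
  have R1: "R \<ge> 1" by (simp add: R_def)
  have RE: "cmod (x - y) \<le> R" if "x \<in> E" "y \<in> E" for x y
    using norm_triangle_ineq4[of x y] b[OF that(1)] b[OF that(2)] by (simp add: R_def)
  obtain \<nu> s where \<nu>: "\<nu> \<in> prob_measures_on E" and s: "strict_mono (s :: nat \<Rightarrow> nat)"
    and lim: "\<And>f :: complex \<Rightarrow> real. continuous_on UNIV f \<Longrightarrow>
       (\<lambda>n. (\<Sum>i<s n. f (z i)) / real (s n)) \<longlonglongrightarrow> integral\<^sup>L \<nu> f"
    by (rule weak_limit_of_averages[OF E, of z]) (simp_all add: zE)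
  interpret prob_space \<nu> by (rule prob_measures_onD[OF \<nu>])
  note AE = prob_measures_onD(3)[OF \<nu>]
  have meas: "f \<in> borel_measurable \<nu>" if "continuous_on UNIV f" for f :: "complex \<Rightarrow> real"
    using borel_measurable_continuous_onI[OF that] measurable_cong_sets[OF prob_measures_onD(2)[OF \<nu>] refl]
    by blast
  have energy: "(\<integral>\<^sup>+ w. (\<integral>\<^sup>+ x. ennreal (truncated_kernel R \<delta> x w) \<partial>\<nu>) \<partial>\<nu>) \<le> ennreal (ln R)"
    if d: "0 < \<delta>" "\<delta> \<le> 1" for \<delta>
  proof -
    let ?K = "truncated_kernel R \<delta>"
    \<comment> \<open>\<open>U\<close> is the truncated potential of the limit measure,
      \<open>a n\<close> that of the averages; both have Lipschitz constant
      \<open>1 / \<delta>\<close>.\<close>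
    define U where "U w = integral\<^sup>L \<nu> (\<lambda>x. ?K x w)" for w
    define a where "a n w = (\<Sum>i<s n. ?K (z i) w) / real (s n)" for n w
    have aU: "(\<lambda>n. a n w) \<longlonglongrightarrow> U w" for w
      unfolding a_def U_def using d R1 by (intro lim continuous_truncated_kernel) auto
    have alip: "\<bar>a n w - a n w'\<bar> \<le> cmod (w - w') / \<delta>" for n w w'
    proof (cases "s n = 0")
      case False
      have "\<bar>a n w - a n w'\<bar> = \<bar>\<Sum>i<s n. ?K (z i) w - ?K (z i) w'\<bar> / real (s n)"
        by (simp add: a_def sum_subtractf flip: diff_divide_distrib)
      also have "\<dots> \<le> (\<Sum>i<s n. cmod (w - w') / \<delta>) / real (s n)"
        using d R1 by (intro divide_right_mono order_trans[OF sum_abs] sum_mono truncated_kernel_lipschitz) auto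
      finally show ?thesis using False by simp
    qed (use d in \<open>simp add: a_def\<close>)
    have Ulip: "\<bar>U w - U w'\<bar> \<le> cmod (w - w') / \<delta>" for w w'
      by (rule tendsto_upperbound[OF tendsto_rabs[OF tendsto_diff[OF aU aU]]])
         (auto intro!: always_eventually alip)
    have Ucont: "continuous_on UNIV U"
    proof (rule continuous_onI)
      fix w e :: real and x :: complex assume "e > 0"
      then show "\<exists>d>0. \<forall>x'\<in>UNIV. dist x' x < d \<longrightarrow> dist (U x') (U x) \<le> e"
      proof (intro exI[of _ "e * \<delta>"] conjI ballI impI)
        fix x' assume "dist x' x < e * \<delta>"
        then have "cmod (x' - x) / \<delta> \<le> e" using d by (simp add: dist_norm field_simps)
        then show "dist (U x') (U x) \<le> e" using Ulip[of x' x] by (simp add: dist_real_def)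
      qed (use d in auto)
    qed
    \<comment> \<open>Pointwise convergence of equi-Lipschitz functions is uniform on a totally
      bounded set. The radius \<open>r\<close> splits the error into three thirds of
      \<open>\<eta>\<close>.\<close>
    have unif: "\<forall>\<^sub>F n in sequentially. \<forall>w\<in>E. U w \<le> a n w + \<eta>" if eta: "\<eta> > 0" for \<eta>
    proof -
      define r where "r = \<eta> * \<delta> / 3"
      have r: "r > 0" using eta d by (simp add: r_def)
      obtain A where A: "finite A" "E \<subseteq> (\<Union>a\<in>A. ball a r)"
        using E r unfolding compact_eq_totally_bounded by blast
      have "\<forall>\<^sub>F n in sequentially. \<forall>c\<in>A. \<bar>a n c - U c\<bar> < \<eta> / 3"
        using tendstoD[OF aU, of "\<eta> / 3"] eta A(1)
        by (intro eventually_ball_finite) (auto simp: dist_real_def)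
      then show ?thesis
      proof eventually_elim
        case (elim n)
        show ?case
        proof
          fix w assume "w \<in> E"
          then obtain c where c: "c \<in> A" "cmod (w - c) < r"
            using A(2) by (auto simp: dist_norm norm_minus_commute)
          then have "cmod (w - c) / \<delta> \<le> \<eta> / 3" using d by (simp add: r_def field_simps)
          moreover have "\<bar>a n c - U c\<bar> < \<eta> / 3" using elim c(1) by blast
          ultimately show "U w \<le> a n w + \<eta>"
            using alip[of n w c] Ulip[of w c] unfolding abs_le_iff abs_less_iff by linarith
        qed
      qed
    qed
    \<comment> \<open>Weak convergence is used a second time, for \<open>U\<close> itself. Replacing
      \<open>U\<close> by \<open>a n\<close> in the average costs \<open>\<eta>\<close> and leaves
      the double sum of \<open>sum_truncated_kernel_le\<close>.\<close>
    have intU: "integral\<^sup>L \<nu> U \<le> ln R"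
    proof (rule field_le_epsilon)
      fix \<eta> :: real assume eta: "\<eta> > 0"
      have sn: "filterlim s at_top sequentially" using s by (rule filterlim_subseq)
      have "(\<lambda>n. ln R + ln (R / \<delta>) / real (s n) + \<eta>) \<longlonglongrightarrow> ln R + 0 + \<eta>"
        by (intro tendsto_intros real_tendsto_divide_at_top[OF tendsto_const]
            filterlim_compose[OF filterlim_real_sequentially sn])
      moreover have "\<forall>\<^sub>F n in sequentially. (\<Sum>j<s n. U (z j)) / real (s n) \<le> ln R + ln (R / \<delta>) / real (s n) + \<eta>"
        using unif[OF eta] eventually_compose_filterlim[OF eventually_gt_at_top[of 0] sn]
      proof eventually_elim
        case (elim n)
        have "(\<Sum>j<s n. U (z j)) \<le> (\<Sum>j<s n. a n (z j) + \<eta>)"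
          using elim(1) zE by (intro sum_mono) auto
        also have "\<dots> = (\<Sum>j<s n. \<Sum>i<s n. ?K (z i) (z j)) / real (s n) + s n * \<eta>"
          by (simp add: sum.distrib a_def sum_divide_distrib)
        also have "\<dots> \<le> (s n * ln (R / \<delta>) + real (s n) * real (s n) * ln R) / real (s n) + s n * \<eta>"
          by (intro add_right_mono divide_right_mono sum_truncated_kernel_le d R1 z) auto
        also have "\<dots> = (ln R + ln (R / \<delta>) / real (s n) + \<eta>) * real (s n)"
          using elim(2) by (simp add: field_simps)
        finally show ?case using elim(2) by (simp add: pos_divide_le_eq)
      qed
      ultimately have "integral\<^sup>L \<nu> U \<le> ln R + 0 + \<eta>"
        by (rule tendsto_le[OF sequentially_bot _ lim[OF Ucont]])
      then show "integral\<^sup>L \<nu> U \<le> ln R + \<eta>" by simp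
    qed
    have K0: "0 \<le> ?K x w" and K1: "?K x w \<le> ln (R / \<delta>)" if "x \<in> E" "w \<in> E" for x w
    proof -
      have "max (cmod (x - w)) \<delta> \<le> R" using RE[OF that] d R1 by simp
      moreover have mp: "max (cmod (x - w)) \<delta> > 0" using d by simp
      ultimately show "0 \<le> ?K x w" unfolding truncated_kernel_def by (intro ln_ge_zero) (simp add: field_simps)
      show "?K x w \<le> ln (R / \<delta>)" unfolding truncated_kernel_def using mp d R1
        by (intro ln_mono divide_left_mono divide_pos_pos mult_pos_pos) auto
    qed
    have inner: "(\<integral>\<^sup>+ x. ennreal (?K x w) \<partial>\<nu>) = ennreal (U w) \<and> 0 \<le> U w \<and> U w \<le> ln (R / \<delta>)" if w: "w \<in> E" for w
    proof -
      have n: "AE x in \<nu>. 0 \<le> ?K x w" using AE by eventually_elim (use K0 w in auto)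
      have m: "AE x in \<nu>. ?K x w \<le> ln (R / \<delta>)" using AE by eventually_elim (use K1 w in auto)
      have i: "integrable \<nu> (\<lambda>x. ?K x w)"
      proof (rule integrable_const_bound)
        show "AE x in \<nu>. norm (?K x w) \<le> ln (R / \<delta>)" using n m by eventually_elim simp
      qed (use d R1 in \<open>auto intro!: meas continuous_truncated_kernel\<close>)
      have "U w \<le> integral\<^sup>L \<nu> (\<lambda>x. ln (R / \<delta>))" unfolding U_def
        by (rule integral_mono_AE[OF i _ m]) simp
      moreover have "0 \<le> U w" unfolding U_def by (rule integral_nonneg_AE[OF n])
      ultimately show ?thesis using nn_integral_eq_integral[OF i n] by (simp add: U_def prob_space)
    qed
    have "(\<integral>\<^sup>+ w. (\<integral>\<^sup>+ x. ennreal (?K x w) \<partial>\<nu>) \<partial>\<nu>) = (\<integral>\<^sup>+ w. ennreal (U w) \<partial>\<nu>)"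
      by (intro nn_integral_cong_AE, use AE in eventually_elim) (use inner in blast)
    also have "\<dots> = ennreal (integral\<^sup>L \<nu> U)"
    proof (rule nn_integral_eq_integral)
      show "AE w in \<nu>. 0 \<le> U w" using AE by eventually_elim (use inner in blast)
      have "AE w in \<nu>. norm (U w) \<le> ln (R / \<delta>)" using AE by eventually_elim (use inner in auto)
      then show "integrable \<nu> U" by (rule integrable_const_bound) (rule meas[OF Ucont])
    qed
    finally show ?thesis using intU by (simp add: ennreal_leI)
  qed
  define d where "d n = 1 / real (Suc n)" for n
  have d: "0 < d n" "d n \<le> 1" for n by (auto simp: d_def)
  have d_mono: "d n \<le> d m" if "m \<le> n" for m n using that by (simp add: d_def frac_le)
  have K_mono: "ennreal (truncated_kernel R (d m) x w) \<le> ennreal (truncated_kernel R (d n) x w)"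
    if "m \<le> n" for m n x w
  proof (rule ennreal_leI)
    have "max (cmod (x - w)) (d n) > 0" for n using d[of n] by simp
    then show "truncated_kernel R (d m) x w \<le> truncated_kernel R (d n) x w"
      unfolding truncated_kernel_def using d_mono[OF that] R1
      by (intro ln_mono divide_left_mono divide_pos_pos mult_pos_pos max.mono) auto
  qed
  \<comment> \<open>On the diagonal the truncations are \<open>ln (R * Suc n)\<close>, hence
    unbounded; off it they are constant once \<open>d n < cmod (x - w)\<close>.\<close>
  have sup: "shifted_kernel R x w = (SUP n. ennreal (truncated_kernel R (d n) x w))" for x w
  proof (cases "x = w")
    case True
    have top: "(SUP n. ennreal (truncated_kernel R (d n) x w)) = top"
    proof (rule ennreal_SUP_eq_top)
      fix n :: nat
      obtain k where k: "exp (real n) \<le> real k" using real_arch_simple by blast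
      have "real n = ln (exp (real n))" by simp
      also have "\<dots> \<le> ln (R * real (Suc k))"
      proof (rule ln_mono)
        have "exp (real n) \<le> 1 * real (Suc k)" using k by simp
        also have "\<dots> \<le> R * real (Suc k)" by (intro mult_right_mono R1 of_nat_0_le_iff)
        finally show "exp (real n) \<le> R * real (Suc k)" .
      qed simp
      also have "\<dots> = truncated_kernel R (d k) x w"
        using True by (simp add: truncated_kernel_def d_def max_absorb2)
      finally have "real n \<le> truncated_kernel R (d k) x w" .
      then show "\<exists>i\<in>UNIV. of_nat n \<le> ennreal (truncated_kernel R (d i) x w)"
        by (metis UNIV_I ennreal_leI ennreal_of_nat_eq_real_of_nat)
    qed
    then show ?thesis unfolding top shifted_kernel_def using True by simp
  next
    case False
    then have pos: "cmod (x - w) > 0" by simp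
    obtain n where n: "d n < cmod (x - w)" using reals_Archimedean[OF pos] by (auto simp: d_def inverse_eq_divide)
    have "(SUP n. ennreal (truncated_kernel R (d n) x w)) = ennreal (ln (R / cmod (x - w)))"
    proof (rule antisym)
      have "ennreal (truncated_kernel R (d n) x w) \<le> ennreal (ln (R / cmod (x - w)))" for n
        unfolding truncated_kernel_def using pos R1 d[of n]
        by (intro ennreal_leI ln_mono divide_left_mono divide_pos_pos mult_pos_pos) auto
      then show "(SUP n. ennreal (truncated_kernel R (d n) x w)) \<le> ennreal (ln (R / cmod (x - w)))"
        by (intro SUP_least)
      have "ln (R / cmod (x - w)) = truncated_kernel R (d n) x w"
        unfolding truncated_kernel_def using n by simp
      then show "ennreal (ln (R / cmod (x - w))) \<le> (SUP n. ennreal (truncated_kernel R (d n) x w))"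
        by (intro SUP_upper2[of n]) simp_all
    qed
    then show ?thesis using False by (simp add: shifted_kernel_def)
  qed
  have Km: "(\<lambda>x. ennreal (truncated_kernel R (d n) (fst x) (snd x))) \<in> borel_measurable (borel \<Otimes>\<^sub>M borel)" for n
    unfolding truncated_kernel_def by measurable
  \<comment> \<open>Monotone convergence, first in the inner integral and then in the outer
    one.\<close>
  have "shifted_energy R \<nu> = (\<integral>\<^sup>+ w. (SUP n. \<integral>\<^sup>+ x. ennreal (truncated_kernel R (d n) x w) \<partial>\<nu>) \<partial>\<nu>)"
    unfolding shifted_energy_def sup
    by (subst nn_integral_monotone_convergence_SUP)
       (auto simp: incseq_def le_fun_def intro!: K_mono section_measurable(1)[OF \<nu> R1 RE Km])
  also have "\<dots> = (SUP n. \<integral>\<^sup>+ w. \<integral>\<^sup>+ x. ennreal (truncated_kernel R (d n) x w) \<partial>\<nu> \<partial>\<nu>)"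
    by (subst nn_integral_monotone_convergence_SUP)
       (auto simp: incseq_def le_fun_def intro!: nn_integral_mono K_mono partial_integral_measurable[OF \<nu> R1 RE Km])
  also have "\<dots> \<le> ennreal (ln R)" by (intro SUP_least energy d)
  finally have le: "shifted_energy R \<nu> \<le> ennreal (ln R)" .
  have "log_energy \<nu> \<le> 0" by (rule log_energy_le_0[OF \<nu> R1 _ le]) (rule RE)
  then show ?thesis using \<nu> by blast
qed

section \<open>Vandermonde determinants\<close>

text \<open>The pairs are ordered, so this is the square of the modulus of the Vandermonde
  determinant.\<close>

definition sq_vandermonde :: "complex set \<Rightarrow> real" where
  "sq_vandermonde S = (\<Prod>x\<in>S. \<Prod>y\<in>S - {x}. cmod (x - y))"

lemma sq_vandermonde_insert:
  assumes "finite S" "x \<notin> S"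
  shows "sq_vandermonde (insert x S) = sq_vandermonde S * (\<Prod>y\<in>S. cmod (x - y))\<^sup>2"
proof -
  have "insert x S - {u} = insert x (S - {u})" if "u \<in> S" for u using assms that by auto
  then have "(\<Prod>u\<in>S. \<Prod>y\<in>insert x S - {u}. cmod (u - y))
      = (\<Prod>u\<in>S. cmod (x - u) * (\<Prod>y\<in>S - {u}. cmod (u - y)))"
    using assms by (intro prod.cong) (auto simp: norm_minus_commute)
  moreover have "insert x S - {x} = S" using assms by auto
  ultimately show ?thesis using assms
    by (simp add: sq_vandermonde_def prod.distrib power2_eq_square mult_ac)
qed

text \<open>A measure of energy below \<open>\<epsilon>\<close> gives points of small discrete
  energy. On exponentiating, the terms \<open>ln R\<close>, one for each ordered pair,
  cancel.\<close>

lemma sq_vandermonde_large: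
  assumes E: "compact E" and rob: "robin_constant E \<le> 0" and \<epsilon>: "\<epsilon> > 0"
  obtains S where "finite S" "S \<subseteq> E" "card S = n" "sq_vandermonde S \<ge> exp (- real (n * (n - 1)) * \<epsilon>)"
proof -
  obtain b where b: "\<And>x. x \<in> E \<Longrightarrow> cmod x \<le> b"
    using compact_imp_bounded[OF E] by (auto simp: bounded_iff)
  define R where "R = 2 * \<bar>b\<bar> + 1"
  have R1: "R \<ge> 1" by (simp add: R_def)
  have RE: "cmod (x - y) \<le> R" if "x \<in> E" "y \<in> E" for x y
    using norm_triangle_ineq4[of x y] b[OF that(1)] b[OF that(2)] by (simp add: R_def)
  have "robin_constant E < ereal \<epsilon>" using rob \<epsilon> by (simp add: le_less_trans)
  then obtain \<nu> where \<nu>: "\<nu> \<in> prob_measures_on E" "log_energy \<nu> < ereal \<epsilon>"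
    unfolding robin_constant_def by (auto simp: INF_less_iff)
  have le: "shifted_energy R \<nu> \<le> ennreal (ln R + \<epsilon>)"
    by (rule shifted_energy_le[OF \<nu>(1) R1 _ \<nu>(2)]) (use RE \<epsilon> in auto)
  then have "shifted_energy R \<nu> < \<infinity>" using le_less_trans by fastforce
  then obtain S where S: "finite S" "S \<subseteq> E" "card S = n"
    "(\<Sum>x\<in>S. \<Sum>y\<in>S - {x}. shifted_kernel R x y) \<le> of_nat (n * (n - 1)) * shifted_energy R \<nu>"
    by (rule discrete_energy_le[OF \<nu>(1) R1, rotated 1]) (use RE in auto)
  have pos: "cmod (x - y) > 0" if "x \<in> S" "y \<in> S - {x}" for x y using that by auto
  have nn: "0 \<le> ln (R / cmod (x - y))" if "x \<in> S" "y \<in> S - {x}" for x y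
    using pos[OF that] RE[of x y] that S(2) by (intro ln_ge_zero) auto
  have "(\<Sum>x\<in>S. \<Sum>y\<in>S - {x}. shifted_kernel R x y)
      = (\<Sum>x\<in>S. \<Sum>y\<in>S - {x}. ennreal (ln (R / cmod (x - y))))"
    by (intro sum.cong) (auto simp: shifted_kernel_def)
  also have "\<dots> = (\<Sum>x\<in>S. ennreal (\<Sum>y\<in>S - {x}. ln (R / cmod (x - y))))"
    by (intro sum.cong refl sum_ennreal nn)
  also have "\<dots> = ennreal (\<Sum>x\<in>S. \<Sum>y\<in>S - {x}. ln (R / cmod (x - y)))"
    by (intro sum_ennreal sum_nonneg nn)
  finally have eq: "(\<Sum>x\<in>S. \<Sum>y\<in>S - {x}. shifted_kernel R x y)
      = ennreal (\<Sum>x\<in>S. \<Sum>y\<in>S - {x}. ln (R / cmod (x - y)))" .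
  have "ennreal (\<Sum>x\<in>S. \<Sum>y\<in>S - {x}. ln (R / cmod (x - y))) \<le> of_nat (n * (n - 1)) * ennreal (ln R + \<epsilon>)"
    using S(4) unfolding eq by (rule order_trans) (rule mult_left_mono[OF le zero_le])
  also have "\<dots> = ennreal (real (n * (n - 1)) * (ln R + \<epsilon>))"
    using R1 \<epsilon> by (subst ennreal_mult') (simp_all only: ennreal_of_nat_eq_real_of_nat of_nat_0_le_iff)
  finally have "(\<Sum>x\<in>S. \<Sum>y\<in>S - {x}. ln (R / cmod (x - y))) \<le> real (n * (n - 1)) * (ln R + \<epsilon>)"
    using R1 \<epsilon> by (subst (asm) ennreal_le_iff) (auto intro!: mult_nonneg_nonneg add_nonneg_nonneg)
  moreover have "(\<Sum>x\<in>S. \<Sum>y\<in>S - {x}. ln (R / cmod (x - y)))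
      = (\<Sum>x\<in>S. \<Sum>y\<in>S - {x}. ln R - ln (cmod (x - y)))"
    using R1 by (intro sum.cong refl) (auto simp: ln_div)
  moreover have "\<dots> = real (n * (n - 1)) * ln R - (\<Sum>x\<in>S. \<Sum>y\<in>S - {x}. ln (cmod (x - y)))"
    using S by (simp add: sum_subtractf)
  ultimately have "- real (n * (n - 1)) * \<epsilon> \<le> (\<Sum>x\<in>S. \<Sum>y\<in>S - {x}. ln (cmod (x - y)))"
    by (simp add: distrib_left)
  also have "\<dots> = (\<Sum>x\<in>S. ln (\<Prod>y\<in>S - {x}. cmod (x - y)))"
    using S(1) pos by (intro sum.cong refl ln_prod[symmetric]) auto
  also have "\<dots> = ln (sq_vandermonde S)"
    unfolding sq_vandermonde_def using S(1) pos by (intro ln_prod[symmetric] prod_pos) auto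
  finally have "- real (n * (n - 1)) * \<epsilon> \<le> ln (sq_vandermonde S)" .
  moreover have "sq_vandermonde S > 0" unfolding sq_vandermonde_def using pos by (intro prod_pos) auto
  ultimately have "exp (- real (n * (n - 1)) * \<epsilon>) \<le> sq_vandermonde S" by (metis exp_le_cancel_iff exp_ln)
  then show thesis using that S by blast
qed

text \<open>Since the suprema of \<open>sq_vandermonde\<close> over \<open>n\<close> points stay at least 1, they cannot drop by
  a factor of 4 from some point on.  Where they do not, removing a point from a nearly optimal
  configuration shows that this point is not close to the others.\<close>
lemma separated_points:
  assumes E: "compact E" and rob: "robin_constant E \<le> 0"
  obtains S where "finite S" "S \<subseteq> E" "card S > N"
    "\<And>x. x \<in> S \<Longrightarrow> (\<Prod>y\<in>S - {x}. cmod (x - y)) \<ge> 1 / 4"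
proof -
  obtain b where b: "\<And>x. x \<in> E \<Longrightarrow> cmod x \<le> b"
    using compact_imp_bounded[OF E] by (auto simp: bounded_iff)
  define R where "R = 2 * \<bar>b\<bar> + 1"
  have R1: "R \<ge> 1" by (simp add: R_def)
  have RE: "cmod (x - y) \<le> R" if "x \<in> E" "y \<in> E" for x y
    using norm_triangle_ineq4[of x y] b[OF that(1)] b[OF that(2)] by (simp add: R_def)
  define V where "V n = sq_vandermonde ` {S. finite S \<and> S \<subseteq> E \<and> card S = n}" for n
  define D where "D n = Sup (V n)" for n
  have bdd: "bdd_above (V n)" for n
  proof (rule bdd_aboveI)
    fix v assume "v \<in> V n"
    then obtain S where S: "finite S" "S \<subseteq> E" "card S = n" "v = sq_vandermonde S" by (auto simp: V_def)
    have "v \<le> (\<Prod>x\<in>S. \<Prod>y\<in>S - {x}. R)" unfolding S(4) sq_vandermonde_def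
      using S RE by (intro prod_mono conjI prod_nonneg) auto
    then show "v \<le> (R ^ (n - 1)) ^ n" using S by simp
  qed
  have D: "sq_vandermonde S \<le> D n" if "finite S" "S \<subseteq> E" "card S = n" for S n
    unfolding D_def using that by (intro cSup_upper bdd) (auto simp: V_def)
  \<comment> \<open>The \<open>\<epsilon>\<close> of \<open>sq_vandermonde_large\<close> tends to 0
    along \<open>inverse (Suc k)\<close>.\<close>
  have D1: "D n \<ge> 1" for n
  proof -
    have "(\<lambda>k. exp (- real (n * (n - 1)) * inverse (real (Suc k)))) \<longlonglongrightarrow> exp (- real (n * (n - 1)) * 0)"
      by (intro tendsto_intros LIMSEQ_inverse_real_of_nat)
    moreover have "\<forall>k. exp (- real (n * (n - 1)) * inverse (real (Suc k))) \<le> D n"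
    proof
      fix k :: nat
      have "inverse (real (Suc k)) > 0" by simp
      from sq_vandermonde_large[OF E rob this, of n] obtain S where
        "finite S" "S \<subseteq> E" "card S = n"
        "sq_vandermonde S \<ge> exp (- real (n * (n - 1)) * inverse (real (Suc k)))" by blast
      then show "exp (- real (n * (n - 1)) * inverse (real (Suc k))) \<le> D n"
        using D order_trans by blast
    qed
    ultimately have "exp (- real (n * (n - 1)) * 0) \<le> D n" by (blast intro: LIMSEQ_le_const2)
    then show ?thesis by simp
  qed
  have "\<exists>n\<ge>N. D (Suc n) \<ge> D n / 4"
  proof (rule ccontr)
    assume "\<not> ?thesis"
    then have *: "D (Suc n) \<le> D n / 4" if "n \<ge> N" for n using that by force
    have dec: "D (N + m) \<le> D N / 4 ^ m" for m
    proof (induction m)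
      case (Suc m)
      then show ?case using *[of "N + m"] by simp
    qed simp
    obtain m where "D N < 4 ^ m" using real_arch_pow[of 4 "D N"] by auto
    then have "D N / 4 ^ m < 1" by simp
    then show False using dec[of m] D1[of "N + m"] by linarith
  qed
  then obtain n where n: "n \<ge> N" "D (Suc n) \<ge> D n / 4" by blast
  have "V (Suc n) \<noteq> {}"
    using sq_vandermonde_large[OF E rob zero_less_one, of "Suc n"] by (auto simp: V_def)
  moreover have "D (Suc n) / 2 < Sup (V (Suc n))" using D1[of "Suc n"] by (simp add: D_def)
  ultimately obtain v where "v \<in> V (Suc n)" "D (Suc n) / 2 < v" by (metis less_cSupE)
  then obtain S where S: "finite S" "S \<subseteq> E" "card S = Suc n" "D (Suc n) / 2 < sq_vandermonde S"
    by (auto simp: V_def)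
  have "(\<Prod>y\<in>S - {x}. cmod (x - y)) \<ge> 1 / 4" if "x \<in> S" for x
  proof -
    let ?\<pi> = "\<Prod>y\<in>S - {x}. cmod (x - y)"
    \<comment> \<open>The lost factors 4 and 2 leave \<open>1 / 8\<close> for the squared product,
      more than the square of \<open>1 / 4\<close>.\<close>
    have "D n / 8 \<le> sq_vandermonde S" using S(4) n(2) by simp
    also have "\<dots> = sq_vandermonde (S - {x}) * ?\<pi>\<^sup>2"
      using sq_vandermonde_insert[of "S - {x}" x] S(1) that by (simp add: insert_absorb)
    also have "\<dots> \<le> D n * ?\<pi>\<^sup>2"
      by (intro mult_right_mono D) (use S that in auto)
    finally have "D n * (1 / 8) \<le> D n * ?\<pi>\<^sup>2" by simp
    then have "1 / 8 \<le> ?\<pi>\<^sup>2" using D1[of n] by (subst (asm) mult_le_cancel_left_pos) auto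
    then have "(1 / 4)\<^sup>2 \<le> ?\<pi>\<^sup>2" by (simp add: power2_eq_square)
    then show ?thesis by (rule power2_le_imp_le) (intro prod_nonneg, simp)
  qed
  then show thesis using that[of S] S n by auto
qed

section \<open>Lagrange interpolation at nearly extremal points\<close>

text \<open>Both sides are polynomials in \<open>z\<close> of degree below \<open>card S\<close>
  that agree at all nodes.\<close>

lemma lagrange_partition_of_unity:
  fixes z :: complex
  assumes "finite S" "S \<noteq> {}"
  shows "(\<Sum>x\<in>S. \<Prod>y\<in>S - {x}. (z - y) / (x - y)) = 1"
proof -
  define L where "L x = smult (1 / (\<Prod>y\<in>S - {x}. x - y)) (\<Prod>y\<in>S - {x}. [:-y, 1:])" for x
  have pL: "poly (L x) w = (\<Prod>y\<in>S - {x}. (w - y) / (x - y))" for x w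
    by (simp add: L_def poly_prod prod_dividef)
  have c: "card S > 0" using assms by (simp add: card_gt_0_iff)
  have "degree (L x) \<le> card S - 1" if "x \<in> S" for x
  proof -
    have "degree (\<Prod>y\<in>S - {x}. [:-y, 1:]) \<le> (\<Sum>y\<in>S - {x}. degree [:-y, 1:])"
      using degree_prod_sum_le[of "S - {x}" "\<lambda>y. [:-y, 1:]"] assms(1) by (simp add: o_def)
    also have "\<dots> = card S - 1" using assms(1) that by simp
    finally show ?thesis unfolding L_def using degree_smult_le order_trans by blast
  qed
  then have "degree (sum L S) \<le> card S - 1" by (intro degree_sum_le assms(1)) auto
  moreover have "poly (sum L S) x = 1" if "x \<in> S" for x
  proof -
    have "poly (L u) x = (if u = x then 1 else 0)" if "u \<in> S" for u
    proof (cases "u = x")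
      case True
      have "(\<Prod>y\<in>S - {x}. (x - y) / (x - y)) = (\<Prod>y\<in>S - {x}. 1)" by (intro prod.cong) auto
      then show ?thesis using True by (simp add: pL)
    next
      case False
      then have "\<exists>y\<in>S - {u}. (x - y) / (u - y) = 0" using \<open>x \<in> S\<close> by (intro bexI[of _ x]) auto
      then show ?thesis using False assms(1) by (simp only: pL if_False) (intro prod_zero, auto)
    qed
    then show ?thesis using that assms(1) by (simp add: poly_sum)
  qed
  ultimately have "sum L S = 1" using c by (intro poly_eqI_degree[of S]) auto
  then have "poly (sum L S) z = 1" by simp
  then show ?thesis by (simp add: poly_sum pL)
qed

text \<open>With \<open>F\<close> the modulus of the node polynomial at \<open>z\<close>, each
  Lagrange basis polynomial is at most \<open>4 * F / d\<close> there. As they sum to 1,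
  \<open>F\<close> cannot be small.\<close>

lemma node_polynomial_lower_bound:
  assumes S: "finite S" "S \<noteq> {}" and sep: "\<And>x. x \<in> S \<Longrightarrow> (\<Prod>y\<in>S - {x}. cmod (x - y)) \<ge> 1 / 4"
    and d: "d > 0" and z: "\<And>x. x \<in> S \<Longrightarrow> cmod (z - x) \<ge> d"
  shows "(\<Prod>y\<in>S. cmod (z - y)) \<ge> d / (4 * card S)"
proof -
  let ?F = "\<Prod>y\<in>S. cmod (z - y)"
  have c: "card S > 0" using S by (simp add: card_gt_0_iff)
  have "1 = cmod (\<Sum>x\<in>S. \<Prod>y\<in>S - {x}. (z - y) / (x - y))"
    by (subst lagrange_partition_of_unity[OF S]) simp
  also have "\<dots> \<le> (\<Sum>x\<in>S. 4 * ?F / d)"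
  proof (rule sum_norm_le)
    fix x assume x: "x \<in> S"
    let ?\<pi> = "\<Prod>y\<in>S - {x}. cmod (x - y)"
    let ?G = "\<Prod>y\<in>S - {x}. cmod (z - y)"
    have G: "?G \<ge> 0" by (intro prod_nonneg) auto
    have F: "?F = cmod (z - x) * ?G" using S(1) x by (rule prod.remove)
    have "cmod (\<Prod>y\<in>S - {x}. (z - y) / (x - y)) = ?G / ?\<pi>"
      by (simp add: prod_norm[symmetric] norm_divide prod_dividef)
    also have "\<dots> \<le> ?G / (1 / 4)" using sep[OF x] G by (intro divide_left_mono mult_pos_pos) auto
    also have "\<dots> \<le> 4 * ?F / d"
      unfolding F using mult_right_mono[OF z[OF x] G] d by (simp add: field_simps)
    finally show "cmod (\<Prod>y\<in>S - {x}. (z - y) / (x - y)) \<le> 4 * ?F / d" .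
  qed
  also have "\<dots> = card S * (4 * ?F / d)" by simp
  finally show ?thesis using d c by (simp add: field_simps)
qed

text \<open>Dilating the roots by a factor \<open>\<rho>\<close> slightly larger than 1 gains a factor \<open>\<rho>\<^bsup>n\<^esup>\<close>, which
  beats the loss in the previous bound.\<close>
lemma large_monic_polynomial:
  assumes E: "compact E" and rob: "robin_constant E \<le> 0" and d: "d > 0"
  obtains q :: "complex poly" where "lead_coeff q = 1" "degree q > 0"
    "\<And>z. (\<And>x. x \<in> E \<Longrightarrow> cmod (z - x) \<ge> d) \<Longrightarrow> cmod (poly q z) \<ge> 2"
proof -
  obtain b where b: "b > 0" "\<And>x. x \<in> E \<Longrightarrow> cmod x \<le> b"
    using compact_imp_bounded[OF E] by (auto simp: bounded_pos)
  \<comment> \<open>Chosen so that the dilation moves points of \<open>E\<close> by at most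
    \<open>d / 2\<close>.\<close>
  define \<rho> where "\<rho> = 1 + d / (2 * b)"
  have l: "\<rho> > 1" and lb: "(\<rho> - 1) * b = d / 2" using b d by (simp_all add: \<rho>_def)
  \<comment> \<open>The threshold \<open>d / (16 * \<rho>)\<close> is what makes
    \<open>\<rho> ^ n * (d / (2 * \<rho>) / (4 * n))\<close> at least 2.\<close>
  have "(\<lambda>n. of_nat n * (1 / \<rho>) ^ n) \<longlonglongrightarrow> 0" using l by (intro powser_times_n_limit_0) auto
  then have "\<forall>\<^sub>F n in sequentially. of_nat n * (1 / \<rho>) ^ n < d / (16 * \<rho>)"
    using d l by (intro order_tendstoD(2)) auto
  then obtain N where N: "\<And>n. n \<ge> N \<Longrightarrow> real n * (1 / \<rho>) ^ n < d / (16 * \<rho>)"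
    by (auto simp: eventually_sequentially)
  obtain S where S: "finite S" "S \<subseteq> E" "card S > N"
    and sep: "\<And>x. x \<in> S \<Longrightarrow> (\<Prod>y\<in>S - {x}. cmod (x - y)) \<ge> 1 / 4"
    using separated_points[OF E rob, of N] by blast
  have ne: "S \<noteq> {}" and c: "card S > 0" using S by auto
  define q where "q = (\<Prod>y\<in>S. [:- (of_real \<rho> * y), 1:])"
  have "cmod (poly q z) \<ge> 2" if z: "\<And>x. x \<in> E \<Longrightarrow> cmod (z - x) \<ge> d" for z
  proof -
    have far: "cmod (z / of_real \<rho> - x) \<ge> d / (2 * \<rho>)" if "x \<in> S" for x
    proof -
      have "x \<in> E" using that S by blast
      have "cmod ((of_real \<rho> - 1) * x) \<le> (\<rho> - 1) * b"
      proof -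
        have "of_real \<rho> - 1 = complex_of_real (\<rho> - 1)" by simp
        then have "cmod ((of_real \<rho> - 1) * x) = (\<rho> - 1) * cmod x"
          using l unfolding norm_mult by (simp only: norm_of_real)
        then show ?thesis using b(2)[OF \<open>x \<in> E\<close>] l by simp
      qed
      then have "d / 2 \<le> cmod (z - x) - cmod ((of_real \<rho> - 1) * x)" using z[OF \<open>x \<in> E\<close>] lb by simp
      also have "\<dots> \<le> cmod (z - of_real \<rho> * x)"
        using norm_triangle_ineq2[of "z - x" "(of_real \<rho> - 1) * x"] by (simp add: algebra_simps)
      also have "z - of_real \<rho> * x = of_real \<rho> * (z / of_real \<rho> - x)"
        using l by (simp add: field_simps)
      also have "cmod \<dots> = \<rho> * cmod (z / of_real \<rho> - x)" using l by (simp add: norm_mult)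
      finally show ?thesis using l by (simp add: field_simps)
    qed
    have lo: "d / (2 * \<rho>) / (4 * card S) \<le> (\<Prod>y\<in>S. cmod (z / of_real \<rho> - y))"
      by (rule node_polynomial_lower_bound[OF S(1) ne sep]) (use far d l in auto)
    have eq: "cmod (poly q z) = \<rho> ^ card S * (\<Prod>y\<in>S. cmod (z / of_real \<rho> - y))"
    proof -
      have "cmod (poly q z) = (\<Prod>y\<in>S. cmod (z - of_real \<rho> * y))"
        by (simp add: q_def poly_prod prod_norm)
      also have "\<dots> = (\<Prod>y\<in>S. \<rho> * cmod (z / of_real \<rho> - y))"
      proof (rule prod.cong[OF refl])
        fix y
        have "z - of_real \<rho> * y = of_real \<rho> * (z / of_real \<rho> - y)"
          using l by (simp add: field_simps)
        then show "cmod (z - of_real \<rho> * y) = \<rho> * cmod (z / of_real \<rho> - y)" using l by (simp add: norm_mult)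
      qed
      finally show ?thesis by (simp add: prod.distrib)
    qed
    have "cmod (poly q z) \<ge> \<rho> ^ card S * (d / (2 * \<rho>) / (4 * card S))"
      unfolding eq by (rule mult_left_mono[OF lo]) (use l in simp)
    moreover have "\<rho> ^ card S * (d / (2 * \<rho>) / (4 * card S)) \<ge> 2"
      using N[of "card S"] S(3) c l by (simp add: field_simps power_one_over)
    ultimately show ?thesis by linarith
  qed
  moreover have "lead_coeff q = 1" unfolding q_def by (simp add: lead_coeff_prod)
  moreover have "degree q = card S"
    unfolding q_def by (subst degree_prod_eq_sum_degree) auto
  ultimately show thesis using that[of q] c by simp
qed

section \<open>Integer polynomials\<close>

text \<open>The product of \<open>q\<close> with the polynomial of conjugate coefficients is its own
  conjugate. Lower bounds for \<open>q\<close> on a conjugation-invariant set carry over to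
  it.\<close>

lemma symmetrize_polynomial:
  fixes q :: "complex poly"
  assumes "lead_coeff q = 1" "degree q > 0"
  obtains r where "lead_coeff r = 1" "degree r > 0" "\<And>n. coeff r n \<in> \<real>"
    "\<And>z. poly r z = poly q z * cnj (poly q (cnj z))"
proof -
  define r where "r = q * map_poly cnj q"
  have deg: "degree (map_poly cnj q) = degree q" by (rule degree_map_poly) simp
  have "q \<noteq> 0" "map_poly cnj q \<noteq> 0" using assms deg by auto
  then have "degree r = degree q + degree q" by (simp add: r_def degree_mult_eq deg)
  moreover have "lead_coeff r = 1" using assms(1) by (simp add: r_def lead_coeff_mult deg coeff_map_poly)
  moreover have pr: "poly r z = poly q z * cnj (poly q (cnj z))" for z
    by (simp add: r_def poly_map_poly_cnj)
  moreover have "coeff r n \<in> \<real>" for n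
  proof -
    have "poly (map_poly cnj r) = poly r" by (simp add: fun_eq_iff poly_map_poly_cnj pr)
    then have "map_poly cnj r = r" by (simp only: poly_eq_poly_eq_iff)
    then have "cnj (coeff r n) = coeff r n" by (metis coeff_map_poly complex_cnj_zero)
    then show ?thesis by (simp add: Reals_cnj_iff)
  qed
  ultimately show thesis using that[of r] assms(2) by simp
qed

text \<open>The coefficients are rounded down to multiples of \<open>1 / D\<close>. The error stays
  under control on an unbounded \<open>W\<close> because powers of \<open>cmod z\<close> up to the
  degree are at most a constant times \<open>cmod (poly r z)\<close> there.\<close>

lemma approximate_by_rational_polynomial:
  fixes r :: "complex poly" and W :: "complex set"
  assumes r: "lead_coeff r = 1" "\<And>n. coeff r n \<in> \<real>" and W: "\<And>z. z \<in> W \<Longrightarrow> cmod (poly r z) \<ge> 4"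
  obtains D :: nat and b C where "D > 0" "\<And>n. coeff b n \<in> \<int>" "\<And>n. n \<ge> degree r \<Longrightarrow> coeff b n = 0" "C > 0"
    "\<And>z. z \<in> W \<Longrightarrow> cmod (poly (monom 1 (degree r) + smult (1 / of_nat D) b) z) \<ge> 2"
    "\<And>z i. z \<in> W \<Longrightarrow> i \<le> degree r \<Longrightarrow>
       cmod z ^ i \<le> C * cmod (poly (monom 1 (degree r) + smult (1 / of_nat D) b) z)"
proof -
  define m where "m = degree r"
  obtain R where R: "R \<ge> 1" "\<And>z. cmod z \<ge> R \<Longrightarrow> cmod (poly r z) \<ge> cmod z ^ m / 2"
    using monic_poly_growth[OF r(1)] unfolding m_def by blast
  define C where "C = 2 * R ^ m"
  have C: "C \<ge> 2" using R(1) one_le_power[of R m] by (simp add: C_def)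
  \<comment> \<open>Far out this is the growth of a monic polynomial; within radius \<open>R\<close>
    it follows from the lower bound on \<open>W\<close>.\<close>
  have growth: "max 1 (cmod z) ^ m \<le> C * cmod (poly r z)" if z: "z \<in> W" for z
  proof (cases "cmod z \<ge> R")
    case True
    then have "max 1 (cmod z) = cmod z" using R(1) by simp
    then have "max 1 (cmod z) ^ m \<le> 2 * cmod (poly r z)" using R(2)[OF True] by simp
    also have "\<dots> \<le> C * cmod (poly r z)" using C by (intro mult_right_mono) auto
    finally show ?thesis .
  next
    case False
    then have "max 1 (cmod z) ^ m \<le> R ^ m * 1" using R(1) by (simp add: power_mono)
    also have "\<dots> \<le> C * cmod (poly r z)" unfolding C_def using W[OF z] R(1) by (intro mult_mono) auto
    finally show ?thesis .
  qed
  \<comment> \<open>Each of the \<open>m\<close> rounding errors is at most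
    \<open>C * cmod (poly r z) / D\<close>; this \<open>D\<close> keeps their sum below half of
    \<open>cmod (poly r z)\<close>.\<close>
  obtain D :: nat where D: "D > 0" "real D \<ge> 2 * real m * C"
    using real_arch_simple[of "max 1 (2 * real m * C)"] by (metis max.bounded_iff of_nat_0_less_iff zero_less_one less_le_trans)
  define b where "b = (\<Sum>i<m. monom (complex_of_int \<lfloor>real D * Re (coeff r i)\<rfloor>) i)"
  have cb: "coeff b n = (if n < m then of_int \<lfloor>real D * Re (coeff r n)\<rfloor> else 0)" for n
    by (simp add: b_def coeff_sum)
  define q where "q = monom 1 m + smult (1 / of_nat D) b"
  have diff: "cmod (poly r z - poly q z) \<le> cmod (poly r z) / 2" if z: "z \<in> W" for z
  proof -
    have "coeff (r - q) n = (if n < m then coeff r n - of_int \<lfloor>real D * Re (coeff r n)\<rfloor> / of_nat D else 0)" for n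
      using r(1) by (auto simp: q_def cb m_def coeff_eq_0 not_less le_less)
    then have "r - q = (\<Sum>i<m. monom (coeff r i - of_int \<lfloor>real D * Re (coeff r i)\<rfloor> / of_nat D) i)"
      by (intro poly_eqI) (simp add: coeff_sum)
    then have "poly r z - poly q z = (\<Sum>i<m. (coeff r i - of_int \<lfloor>real D * Re (coeff r i)\<rfloor> / of_nat D) * z ^ i)"
      by (simp add: poly_sum poly_monom flip: poly_diff)
    also have "cmod \<dots> \<le> (\<Sum>i<m. 1 / real D * (C * cmod (poly r z)))"
    proof (rule sum_norm_le)
      fix i assume i: "i \<in> {..<m}"
      have "coeff r i - of_int \<lfloor>real D * Re (coeff r i)\<rfloor> / of_nat D
          = complex_of_real (frac (real D * Re (coeff r i)) / real D)"
        using r(2)[of i] D(1) by (auto elim!: Reals_cases simp: frac_def field_simps)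
      then have "cmod (coeff r i - of_int \<lfloor>real D * Re (coeff r i)\<rfloor> / of_nat D) \<le> 1 / real D"
        using frac_lt_1[of "real D * Re (coeff r i)"] frac_ge_0[of "real D * Re (coeff r i)"]
        by (simp only: norm_of_real) (simp add: divide_right_mono)
      moreover have "cmod z ^ i \<le> C * cmod (poly r z)"
      proof -
        have "cmod z ^ i \<le> max 1 (cmod z) ^ i" by (intro power_mono) auto
        also have "\<dots> \<le> max 1 (cmod z) ^ m" using i by (intro power_increasing) auto
        finally show ?thesis using growth[OF z] by linarith
      qed
      ultimately show "cmod ((coeff r i - of_int \<lfloor>real D * Re (coeff r i)\<rfloor> / of_nat D) * z ^ i)
          \<le> 1 / real D * (C * cmod (poly r z))"
        unfolding norm_mult norm_power by (intro mult_mono) auto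
    qed
    also have "\<dots> = (2 * real m * C) / real D * (cmod (poly r z) / 2)" by simp
    also have "\<dots> \<le> 1 * (cmod (poly r z) / 2)"
      using D by (intro mult_right_mono) auto
    finally show ?thesis by simp
  qed
  have half: "cmod (poly r z) \<le> 2 * cmod (poly q z)" if z: "z \<in> W" for z
    using diff[OF z] norm_triangle_ineq2[of "poly r z" "poly q z"] by linarith
  have "cmod z ^ i \<le> 2 * C * cmod (poly q z)" if z: "z \<in> W" and i: "i \<le> m" for z i
  proof -
    have "cmod z ^ i \<le> max 1 (cmod z) ^ i" by (intro power_mono) auto
    also have "\<dots> \<le> max 1 (cmod z) ^ m" using i by (intro power_increasing) auto
    also have "\<dots> \<le> C * cmod (poly r z)" by (rule growth[OF z])
    also have "\<dots> \<le> C * (2 * cmod (poly q z))" using half[OF z] C by (intro mult_left_mono) auto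
    finally show ?thesis by simp
  qed
  moreover have "cmod (poly q z) \<ge> 2" if z: "z \<in> W" for z
    using half[OF z] W[OF z] by linarith
  ultimately show thesis
    using that[of D b "2 * C"] D(1) C cb unfolding q_def m_def by simp
qed

section \<open>Rounding powers of a rational polynomial to integer coefficients\<close>

text \<open>Stated for a set closed under sums and products, so that it serves both
  \<open>\<int>\<close> and \<open>\<real>\<close>.\<close>

lemma coeff_mult_closed:
  assumes "0 \<in> A" "\<And>x y. x \<in> A \<Longrightarrow> y \<in> A \<Longrightarrow> x + y \<in> A" "\<And>x y. x \<in> A \<Longrightarrow> y \<in> A \<Longrightarrow> x * y \<in> A"
    and "\<And>n. coeff p n \<in> A" "\<And>n. coeff q n \<in> A"
  shows "coeff (p * q) n \<in> (A :: 'a :: comm_semiring_0 set)"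
proof -
  have "sum f S \<in> A" if "finite S" "\<And>i. i \<in> S \<Longrightarrow> f i \<in> A" for S :: "nat set" and f
    using that assms(1,2) by (induction S rule: finite_induct) auto
  then show ?thesis unfolding coeff_mult using assms by auto
qed

lemma coeff_power_closed:
  assumes "0 \<in> A" "\<And>x y. x \<in> A \<Longrightarrow> y \<in> A \<Longrightarrow> x + y \<in> A" "\<And>x y. x \<in> A \<Longrightarrow> y \<in> A \<Longrightarrow> x * y \<in> A"
    and "1 \<in> A" "\<And>n. coeff p n \<in> A"
  shows "coeff (p ^ k) n \<in> (A :: 'a :: comm_semiring_1 set)"
proof (induction k arbitrary: n)
  case 0
  then show ?case using assms by (simp add: coeff_1)
next
  case (Suc k)
  then show ?case unfolding power_Suc by (intro coeff_mult_closed assms)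
qed

text \<open>In \<open>s * (N choose s) = N * ((N - 1) choose (s - 1))\<close>, \<open>s\<close>
  divides \<open>fact L\<close>, so cancelling it leaves the full factor
  \<open>D ^ L\<close>.\<close>

lemma power_dvd_binomial:
  fixes D L s N :: nat
  assumes "fact L * D ^ L dvd N" "s < L"
  shows "D ^ s dvd N choose s"
proof (cases s)
  case (Suc s')
  then have "s \<le> L" "s \<ge> 1" using assms(2) by auto
  then have "s dvd fact L" by (simp add: dvd_fact)
  then obtain c where c: "fact L = s * c" by blast
  obtain t where t: "N = fact L * D ^ L * t" using assms(1) by blast
  show ?thesis
  proof (cases "N = 0")
    case False
    then obtain N' where N': "N = Suc N'" by (cases N) auto
    have "s * (N choose s) = N * (N' choose s')"
      unfolding N' Suc by (rule Suc_times_binomial)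
    also have "\<dots> = s * (c * D ^ L * t * (N' choose s'))" by (simp add: t c)
    finally have "N choose s = D ^ L * (c * t * (N' choose s'))" using \<open>s \<ge> 1\<close> by (simp add: mult_ac)
    moreover have "D ^ s dvd D ^ L" using \<open>s \<le> L\<close> by (rule le_imp_power_dvd)
    ultimately show ?thesis by simp
  qed (simp add: Suc)
qed simp

text \<open>In the binomial expansion, terms with \<open>s < L\<close> are integral because
  \<open>D ^ s\<close> divides the binomial coefficient. The others do not reach degree
  \<open>j\<close>, since each factor \<open>b\<close> costs at least one degree.\<close>

lemma top_coeffs_integral:
  fixes b :: "complex poly" and D L m N :: nat
  assumes D: "D > 0" and b: "\<And>n. coeff b n \<in> \<int>" "\<And>n. n \<ge> m \<Longrightarrow> coeff b n = 0"
    and N: "fact L * D ^ L dvd N" and j: "j + L > m * N"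
  shows "coeff ((monom 1 m + smult (1 / of_nat D) b) ^ N) j \<in> \<int>"
proof -
  have "(monom 1 m + smult (1 / of_nat D) b) ^ N
      = (\<Sum>s\<le>N. of_nat (N choose s) * smult (1 / of_nat D) b ^ s * monom 1 m ^ (N - s))"
    by (subst add.commute) (rule binomial_ring)
  also have "\<dots> = (\<Sum>s\<le>N. smult (of_nat (N choose s) / of_nat D ^ s) (b ^ s * monom 1 (m * (N - s))))"
    by (intro sum.cong refl)
       (simp add: smult_power monom_power of_nat_poly power_inverse divide_inverse mult_ac)
  finally have eq: "coeff ((monom 1 m + smult (1 / of_nat D) b) ^ N) j
      = (\<Sum>s\<le>N. of_nat (N choose s) / of_nat D ^ s * coeff (b ^ s * monom 1 (m * (N - s))) j)"
    by (simp add: coeff_sum)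
  have "of_nat (N choose s) / of_nat D ^ s * coeff (b ^ s * monom 1 (m * (N - s))) j \<in> \<int>" if s: "s \<le> N" for s
  proof (cases "s < L")
    case True
    then obtain c where "N choose s = D ^ s * c" using power_dvd_binomial[OF N] by blast
    then have "of_nat (N choose s) / of_nat D ^ s = (of_nat c :: complex)" using D by simp
    moreover have "coeff (b ^ s * monom 1 (m * (N - s))) j \<in> \<int>"
      by (intro coeff_mult_closed coeff_power_closed b) (auto simp: coeff_monom)
    ultimately show ?thesis by simp
  next
    case False
    have "coeff (b ^ s * monom 1 (m * (N - s))) j = 0"
    proof (cases "b = 0 \<or> m = 0")
      case True
      then have "b = 0" using b(2) by (auto intro: poly_eqI)
      show ?thesis
      \<comment> \<open>Here \<open>s = 0\<close> means \<open>L = 0\<close>, hence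
        \<open>j > m * N\<close>; for other \<open>s\<close> the factor \<open>b ^ s\<close>
        vanishes.\<close>
      proof (cases "s = 0")
        case True
        then show ?thesis using j False by (simp add: coeff_monom)
      qed (simp add: \<open>b = 0\<close> power_0_left)
    next
      case nz: False
      have "degree b < m" using nz b(2)[of "degree b"] by (metis leading_coeff_0_iff not_le)
      have "degree (b ^ s) \<le> (m - 1) * s"
        using degree_power_le[of b s] mult_right_mono[of "degree b" "m - 1" s] \<open>degree b < m\<close> by linarith
      moreover have "degree (b ^ s * monom 1 (m * (N - s))) \<le> degree (b ^ s) + m * (N - s)"
        using degree_mult_le[of "b ^ s" "monom 1 (m * (N - s))"] by (simp add: degree_monom_eq)
      moreover have "(m - 1) * s + s = m * s" using nz by (cases m) auto
      moreover have "m * s + m * (N - s) = m * N" using s by (simp flip: distrib_left)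
      ultimately have "degree (b ^ s * monom 1 (m * (N - s))) < j" using j False by linarith
      then show ?thesis by (rule coeff_eq_0)
    qed
    then show ?thesis by simp
  qed
  then show ?thesis unfolding eq by (intro Ints_sum) auto
qed

text \<open>Work downwards from the top index: subtracting the fractional part of coefficient
  \<open>j\<close> times the monic \<open>e j\<close> leaves all higher coefficients
  untouched.\<close>

lemma round_low_coeffs:
  fixes G :: "complex poly" and e :: "nat \<Rightarrow> complex poly"
  assumes "\<And>n. coeff G n \<in> \<real>" "\<And>n. n \<ge> J \<Longrightarrow> coeff G n \<in> \<int>"
    and "\<And>j. degree (e j) = j" "\<And>j. coeff (e j) j = 1" "\<And>j n. coeff (e j) n \<in> \<real>"
  obtains t :: "nat \<Rightarrow> real" where "\<And>j. 0 \<le> t j \<and> t j \<le> 1"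
    "\<And>n. coeff (G - (\<Sum>j<J. smult (of_real (t j)) (e j))) n \<in> \<int>"
proof -
  have "\<exists>t :: nat \<Rightarrow> real. (\<forall>j. 0 \<le> t j \<and> t j \<le> 1) \<and>
      (\<forall>n. coeff (G - (\<Sum>j<J. smult (of_real (t j)) (e j))) n \<in> \<int>)"
    using assms(1,2)
  proof (induction J arbitrary: G)
    case 0
    then show ?case by (intro exI[of _ "\<lambda>_. 0"]) auto
  next
    case (Suc J)
    define f where "f = frac (Re (coeff G J))"
    have f: "0 \<le> f" "f \<le> 1" using frac_lt_1 less_imp_le by (auto simp: f_def)
    define G' where "G' = G - smult (of_real f) (e J)"
    have real: "coeff G' n \<in> \<real>" for n
      using Suc.prems(1)[of n] assms(5)[of J n] by (auto simp: G'_def intro!: Reals_diff Reals_mult)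
    have int: "coeff G' n \<in> \<int>" if "n \<ge> J" for n
    proof (cases "n = J")
      case True
      have "coeff G J = of_real (Re (coeff G J))" using Suc.prems(1)[of J] by (auto elim!: Reals_cases)
      then have "coeff G' J = of_real (Re (coeff G J)) - of_real f" using assms(4) by (simp add: G'_def)
      also have "\<dots> = of_int \<lfloor>Re (coeff G J)\<rfloor>" by (simp add: f_def frac_def)
      finally show ?thesis using True by simp
    next
      case False
      then have "coeff (e J) n = 0" using that assms(3)[of J] by (intro coeff_eq_0) auto
      then show ?thesis using Suc.prems(2)[of n] that False by (simp add: G'_def)
    qed
    obtain t :: "nat \<Rightarrow> real" where t: "\<And>j. 0 \<le> t j \<and> t j \<le> 1"
        "\<And>n. coeff (G' - (\<Sum>j<J. smult (of_real (t j)) (e j))) n \<in> \<int>"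
      using Suc.IH[OF real int] by blast
    have eq: "G - (\<Sum>j<Suc J. smult (of_real ((t(J := f)) j)) (e j)) = G' - (\<Sum>j<J. smult (of_real (t j)) (e j))"
      by (simp add: G'_def)
    show ?case
      by (intro exI[of _ "t(J := f)"] conjI allI, unfold eq) (use t f in auto)
  qed
  then show thesis using that by blast
qed

text \<open>A geometric series with every power repeated \<open>m\<close> times; the ratio at least
  2 lets the next power dominate.\<close>

lemma sum_power_div_le:
  fixes a :: real
  assumes "a \<ge> 2" "m > 0"
  shows "(\<Sum>j<m * K. a ^ (j div m)) \<le> m * a ^ K"
proof (induction K)
  case (Suc K)
  have "(\<Sum>j<m * Suc K. a ^ (j div m)) = (\<Sum>j<m * K. a ^ (j div m)) + (\<Sum>j=m * K..<m * K + m. a ^ (j div m))"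
    using sum.atLeastLessThan_concat[of 0 "m * K" "m * K + m" "\<lambda>j. a ^ (j div m)"]
    by (simp add: lessThan_atLeast0 add.commute)
  also have "(\<Sum>j=m * K..<m * K + m. a ^ (j div m)) = (\<Sum>j=m * K..<m * K + m. a ^ K)"
  proof (intro sum.cong refl)
    fix j assume "j \<in> {m * K..<m * K + m}"
    then have "j div m = K" by (intro div_nat_eqI) (auto simp: mult.commute)
    then show "a ^ (j div m) = a ^ K" by simp
  qed
  also have "(\<Sum>j<m * K. a ^ (j div m)) + \<dots> \<le> m * a ^ K + m * a ^ K" using Suc.IH by simp
  also have "\<dots> = 2 * (m * a ^ K)" by simp
  also have "\<dots> \<le> a * (m * a ^ K)" using assms by (intro mult_right_mono) auto
  finally show ?case by (simp add: mult_ac)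
qed simp

text \<open>A power \<open>q ^ N\<close> with integral top coefficients is rounded by polynomials
  controlled by powers of \<open>q\<close> on \<open>W\<close>. The total change is at most half of
  \<open>q ^ N\<close> there.\<close>

lemma large_integer_polynomial:
  fixes q b :: "complex poly" and D m :: nat
  assumes D: "D > 0" and b: "\<And>n. coeff b n \<in> \<int>" "\<And>n. n \<ge> m \<Longrightarrow> coeff b n = 0" and m: "m > 0"
    and q: "q = monom 1 m + smult (1 / of_nat D) b"
    and W: "\<And>z. z \<in> W \<Longrightarrow> cmod (poly q z) \<ge> 2"
    and C: "C > 0" "\<And>z i. z \<in> W \<Longrightarrow> i \<le> m \<Longrightarrow> cmod z ^ i \<le> C * cmod (poly q z)"
  obtains P :: "int poly" where "lead_coeff P = 1" "degree P \<ge> n"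
    "\<And>z. z \<in> W \<Longrightarrow> cmod (poly (map_poly of_int P) z) \<ge> 2 * max \<rho> (cmod z)"
proof -
  have qm: "coeff q m = 1" using b(2)[of m] by (simp add: q)
  have dq: "degree q = m"
  proof (rule antisym)
    show "degree q \<le> m" by (rule degree_le) (use b(2) in \<open>auto simp: q\<close>)
    show "m \<le> degree q" by (rule le_degree) (simp add: qm)
  qed
  have q_real: "coeff q i \<in> \<real>" for i
    using b(1)[of i] by (auto simp: q elim!: Ints_cases intro!: Reals_add Reals_mult Reals_divide)
  have lcpow: "coeff (q ^ k) (m * k) = 1" and dpow: "degree (q ^ k) = m * k" for k
  proof -
    have "q \<noteq> 0" using qm by auto
    then show "degree (q ^ k) = m * k" by (simp add: degree_power_eq dq)
    then show "coeff (q ^ k) (m * k) = 1" using lead_coeff_power[of q k] qm dq by simp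
  qed
  \<comment> \<open>On \<open>W\<close>, with \<open>a = cmod (poly q z) \<ge> 2\<close>, the factor
    \<open>a ^ l0\<close> outweighs \<open>2 * m * C\<close>. The extra 1 in \<open>l\<close>
    absorbs the factor \<open>a\<close> in the bound for \<open>cmod z ^ i\<close>.\<close>
  obtain l0 where l0: "2 * real m * C \<le> 2 ^ l0"
    using real_arch_pow[of 2 "2 * real m * C"] by (auto intro: less_imp_le)
  define l where "l = Suc l0"
  \<comment> \<open>With this \<open>L\<close>, the integral range \<open>j + L > m * N\<close> is
    exactly \<open>j \<ge> J\<close>.\<close>
  define L where "L = m * l + 1"
  define N0 where "N0 = fact L * D ^ L"
  have N0: "N0 > 0" using D by (simp add: N0_def)
  \<comment> \<open>Reserved for the final comparison of \<open>a ^ N / 2\<close> with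
    \<open>2 * \<rho>\<close> and \<open>2 * cmod z\<close>.\<close>
  obtain k0 where k0: "max (4 * \<rho>) (4 * C) \<le> 2 ^ k0"
    using real_arch_pow[of 2 "max (4 * \<rho>) (4 * C)"] by (auto intro: less_imp_le)
  define N where "N = N0 * (l + n + Suc k0)"
  have "1 * (l + n + Suc k0) \<le> N" unfolding N_def using N0 by (intro mult_right_mono) auto
  then have N: "N \<ge> l" "N \<ge> n" "N \<ge> Suc k0" by auto
  define J where "J = m * (N - l)"
  have JN: "J < m * N" using N m by (simp add: J_def l_def)
  \<comment> \<open>Monic of degree \<open>j\<close>, and on \<open>W\<close> at most
    \<open>C * a * a ^ (j div m)\<close> in modulus.\<close>
  define e where "e j = monom 1 (j mod m) * q ^ (j div m)" for j
  have e: "degree (e j) = j" "coeff (e j) j = 1" "coeff (e j) i \<in> \<real>" for j i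
  proof -
    have j: "j mod m + m * (j div m) = j" by simp
    have "q ^ (j div m) \<noteq> 0" using qm by auto
    then show dj: "degree (e j) = j"
      unfolding e_def by (subst degree_mult_eq) (simp_all add: degree_monom_eq dpow)
    have "coeff (monom 1 a * p) (a + k) = coeff p k" for a k and p :: "complex poly"
      by (simp add: coeff_monom_mult)
    from this[of "j mod m" "q ^ (j div m)" "m * (j div m)"] show "coeff (e j) j = 1"
      unfolding j lcpow e_def .
    show "coeff (e j) i \<in> \<real>" unfolding e_def
      by (intro coeff_mult_closed coeff_power_closed q_real) (auto simp: coeff_monom)
  qed
  obtain t :: "nat \<Rightarrow> real" where t: "\<And>j. 0 \<le> t j \<and> t j \<le> 1"
    "\<And>i. coeff (q ^ N - (\<Sum>j<J. smult (of_real (t j)) (e j))) i \<in> \<int>"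
  proof (rule round_low_coeffs[of "q ^ N" J e])
    show "coeff (q ^ N) i \<in> \<real>" for i by (intro coeff_power_closed q_real) auto
    show "coeff (q ^ N) i \<in> \<int>" if "i \<ge> J" for i
      unfolding q
    proof (rule top_coeffs_integral[OF D b, where L = L])
      show "fact L * D ^ L dvd N" by (simp add: N_def N0_def)
      have "m * N = J + m * l" using N by (simp add: J_def flip: distrib_left)
      then show "m * N < i + L" using that by (simp add: L_def)
    qed
  qed (use e in auto)
  define Q where "Q = q ^ N - (\<Sum>j<J. smult (of_real (t j)) (e j))"
  have low: "coeff (\<Sum>j<J. smult (of_real (t j)) (e j)) i = 0" if "i \<ge> J" for i
  proof -
    have "coeff (e j) i = 0" if "j < J" for j using that \<open>i \<ge> J\<close> e(1)[of j] by (intro coeff_eq_0) simp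
    then show ?thesis by (simp add: coeff_sum)
  qed
  have Qlc: "coeff Q (m * N) = 1" using low[of "m * N"] JN lcpow[of N] by (simp add: Q_def)
  have Qdeg: "degree Q = m * N"
  proof (rule antisym)
    show "degree Q \<le> m * N"
      by (rule degree_le) (use low JN dpow[of N] in \<open>auto simp: Q_def intro!: coeff_eq_0\<close>)
    show "m * N \<le> degree Q" by (rule le_degree) (simp add: Qlc)
  qed
  \<comment> \<open>The coefficients of \<open>Q\<close> are integers already, so the floor only
    changes their type.\<close>
  define P where "P = map_poly (\<lambda>x. \<lfloor>Re x\<rfloor>) Q"
  have PQ: "map_poly of_int P = Q"
  proof (rule poly_eqI)
    fix i
    have "coeff Q i \<in> \<int>" using t(2) by (simp add: Q_def)
    then show "coeff (map_poly of_int P) i = coeff Q i"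
      by (auto simp: P_def coeff_map_poly elim!: Ints_cases)
  qed
  have Pcoeff: "of_int (coeff P i) = coeff Q i" for i
    using PQ by (metis coeff_map_poly of_int_0)
  have Pdeg: "degree P = m * N" unfolding Qdeg[symmetric] PQ[symmetric]
    by (rule degree_map_poly[symmetric]) auto
  have "complex_of_int (lead_coeff P) = 1" using Pcoeff[of "m * N"] by (simp add: Pdeg Qlc)
  then have "lead_coeff P = 1" by simp
  moreover have "degree P \<ge> n"
  proof -
    have "1 * n \<le> m * N" using m N by (intro mult_mono) auto
    then show ?thesis by (simp add: Pdeg)
  qed
  moreover have "cmod (poly (map_poly of_int P) z) \<ge> 2 * max \<rho> (cmod z)" if z: "z \<in> W" for z
  proof -
    define a where "a = cmod (poly q z)"
    have a: "a \<ge> 2" using W[OF z] by (simp add: a_def)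
    have "cmod (poly (\<Sum>j<J. smult (of_real (t j)) (e j)) z) \<le> (\<Sum>j<J. C * a * a ^ (j div m))"
      unfolding poly_sum
    proof (rule sum_norm_le)
      fix j
      have "cmod (poly (smult (of_real (t j)) (e j)) z) = t j * (cmod z ^ (j mod m) * a ^ (j div m))"
        using t(1)[of j] by (simp add: e_def poly_monom norm_mult norm_power a_def)
      also have "\<dots> \<le> 1 * (C * a * a ^ (j div m))"
        using t(1)[of j] C(2)[OF z, of "j mod m"] m a
        by (intro mult_mono mult_right_mono) (auto simp: a_def mod_less_divisor less_imp_le)
      finally show "cmod (poly (smult (of_real (t j)) (e j)) z) \<le> C * a * a ^ (j div m)" by simp
    qed
    also have "\<dots> = C * a * (\<Sum>j<J. a ^ (j div m))" by (simp add: sum_distrib_left)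
    also have "\<dots> \<le> C * a * (m * a ^ (N - l))"
      unfolding J_def using C(1) a by (intro mult_left_mono sum_power_div_le m) auto
    also have "\<dots> = (2 * real m * C) * a ^ (N - l0) / 2"
    proof -
      have "N - l0 = Suc (N - l)" using N by (simp add: l_def)
      then show ?thesis by simp
    qed
    also have "\<dots> \<le> a ^ l0 * a ^ (N - l0) / 2"
    proof -
      have "2 * real m * C \<le> a ^ l0" using l0 power_mono[of 2 a l0] a by linarith
      then show ?thesis using a by (intro divide_right_mono mult_right_mono) auto
    qed
    also have "a ^ l0 * a ^ (N - l0) = a ^ N" using N by (simp add: l_def flip: power_add)
    finally have err: "cmod (poly (\<Sum>j<J. smult (of_real (t j)) (e j)) z) \<le> a ^ N / 2" .
    have "cmod (poly (q ^ N) z) - cmod (poly (\<Sum>j<J. smult (of_real (t j)) (e j)) z) \<le> cmod (poly Q z)"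
      unfolding Q_def poly_diff by (rule norm_triangle_ineq2)
    then have PN: "cmod (poly Q z) \<ge> a ^ N / 2" using err by (simp add: norm_power a_def)
    obtain N' where N': "N = Suc N'" "N' \<ge> k0" using N(3) by (cases N) auto
    have "2 ^ k0 \<le> a ^ N'"
      using power_increasing[OF N'(2), of "2 :: real"] power_mono[of 2 a N'] a by linarith
    then have big: "4 * \<rho> \<le> a ^ N'" "4 * C \<le> a ^ N'" using k0 by auto
    have "4 * cmod z \<le> 4 * (C * a)" using C(2)[OF z, of 1] m by (simp add: a_def)
    also have "\<dots> \<le> a ^ N' * a" using mult_right_mono[OF big(2), of a] a by simp
    finally have 1: "4 * cmod z \<le> a ^ N" by (simp add: N' mult.commute)
    have "4 * \<rho> \<le> 1 * a ^ N'" using big by simp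
    also have "\<dots> \<le> a * a ^ N'" using a by (intro mult_right_mono) auto
    finally have 2: "4 * \<rho> \<le> a ^ N" by (simp add: N')
    show ?thesis unfolding PQ using 1 2 PN by (simp add: max_def)
  qed
  ultimately show thesis using that by blast
qed

text \<open>From a point of \<open>W\<close> the modulus becomes at least \<open>2 * \<rho>\<close>
  and then doubles at every step, so the orbit stays in \<open>W\<close> and is unbounded.\<close>

lemma filled_julia_avoids:
  assumes P: "\<And>z. z \<in> W \<Longrightarrow> cmod (poly p z) \<ge> 2 * max \<rho> (cmod z)"
    and W: "\<And>z. cmod z > \<rho> \<Longrightarrow> z \<in> W" and \<rho>: "\<rho> > 0"
  shows "filled_julia p \<inter> W = {}"
proof -
  have False if z: "z \<in> W" "z \<in> filled_julia p" for z
  proof -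
    obtain B where B: "\<And>n. cmod ((poly p ^^ n) z) \<le> B"
      using z(2) by (auto simp: filled_julia_def bounded_iff)
    have "(poly p ^^ n) z \<in> W \<and> cmod ((poly p ^^ Suc n) z) \<ge> 2 ^ Suc n * \<rho>" for n
    proof (induction n)
      case 0
      then show ?case using P[OF z(1)] z(1) by auto
    next
      case (Suc n)
      have "1 * \<rho> < 2 ^ Suc n * \<rho>"
        using one_less_power[of "2 :: real" "Suc n"] \<rho> by (intro mult_strict_right_mono) auto
      then have "(poly p ^^ Suc n) z \<in> W" using Suc by (intro W) linarith
      moreover have "cmod ((poly p ^^ Suc (Suc n)) z) \<ge> 2 * cmod ((poly p ^^ Suc n) z)"
        using P[OF calculation] by simp
      ultimately show ?case using Suc by auto
    qed
    then have ge: "2 ^ Suc n * \<rho> \<le> B" for n using B order_trans by blast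
    obtain n where "B / \<rho> < 2 ^ n" using real_arch_pow[of 2 "B / \<rho>"] by auto
    then have "B < 2 ^ n * \<rho>" using \<rho> by (simp add: field_simps)
    also have "\<dots> \<le> 2 ^ Suc n * \<rho>" using \<rho> by simp
    finally show False using ge[of n] by simp
  qed
  then show ?thesis by blast
qed

lemma integer_polynomials_from_capacity:
  fixes E U :: "complex set"
  assumes E: "compact E" and sym: "\<forall>z\<in>E. cnj z \<in> E" and rob: "robin_constant E \<le> 0"
    and U: "open U" "E \<subseteq> U"
  obtains P :: "int poly" where "lead_coeff P = 1" "degree P \<ge> n" "filled_julia (map_poly of_int P) \<subseteq> U"
proof -
  obtain d where d: "d > 0" "(\<Union>x\<in>E. ball x d) \<subseteq> U"
    using compact_subset_open_imp_ball_epsilon_subset[OF E U] by blast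
  obtain c where c: "c > 0" "\<And>x. x \<in> E \<Longrightarrow> cmod x \<le> c"
    using compact_imp_bounded[OF E] by (auto simp: bounded_pos)
  define W where "W = {z. \<forall>x\<in>E. cmod (z - x) \<ge> d}"
  have WU: "- W \<subseteq> U"
  proof
    fix z assume "z \<in> - W"
    then obtain x where "x \<in> E" "cmod (z - x) < d" by (auto simp: W_def not_le)
    then have "z \<in> ball x d" by (simp add: dist_norm norm_minus_commute)
    then show "z \<in> U" using d(2) \<open>x \<in> E\<close> by blast
  qed
  \<comment> \<open>The symmetry of \<open>E\<close> enters here: both factors of \<open>r\<close>
    are at least 2 on \<open>W\<close>.\<close>
  have Wcnj: "cnj z \<in> W" if "z \<in> W" for z
  proof -
    have "cmod (cnj z - x) = cmod (z - cnj x)" for x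
      by (metis complex_cnj_cnj complex_cnj_diff complex_mod_cnj)
    then show ?thesis using that sym by (auto simp: W_def)
  qed
  obtain q where q: "lead_coeff q = 1" "degree q > 0" "\<And>z. z \<in> W \<Longrightarrow> cmod (poly q z) \<ge> 2"
    using large_monic_polynomial[OF E rob d(1)] unfolding W_def by (metis (mono_tags, lifting) mem_Collect_eq)
  obtain r where r: "lead_coeff r = 1" "degree r > 0" "\<And>n. coeff r n \<in> \<real>"
    "\<And>z. poly r z = poly q z * cnj (poly q (cnj z))"
    using symmetrize_polynomial[OF q(1,2)] by blast
  have r4: "cmod (poly r z) \<ge> 4" if "z \<in> W" for z
    using mult_mono[OF q(3)[OF that] q(3)[OF Wcnj[OF that]]] by (simp add: r(4) norm_mult)
  obtain D :: nat and b C where ap: "D > 0" "\<And>n. coeff b n \<in> \<int>" "\<And>n. n \<ge> degree r \<Longrightarrow> coeff b n = 0"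
    "C > 0"
    "\<And>z. z \<in> W \<Longrightarrow> cmod (poly (monom 1 (degree r) + smult (1 / of_nat D) b) z) \<ge> 2"
    "\<And>z i. z \<in> W \<Longrightarrow> i \<le> degree r \<Longrightarrow>
       cmod z ^ i \<le> C * cmod (poly (monom 1 (degree r) + smult (1 / of_nat D) b) z)"
    by (rule approximate_by_rational_polynomial[OF r(1,3) r4]) blast+
  \<comment> \<open>Points of modulus above \<open>c + d\<close> have distance at least
    \<open>d\<close> from \<open>E\<close>, so they lie in \<open>W\<close>.\<close>
  define \<rho> where "\<rho> = c + d"
  obtain P :: "int poly" where P: "lead_coeff P = 1" "degree P \<ge> n"
    "\<And>z. z \<in> W \<Longrightarrow> cmod (poly (map_poly of_int P) z) \<ge> 2 * max \<rho> (cmod z)"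
    by (rule large_integer_polynomial[OF ap(1-3) r(2) refl ap(5) ap(4) ap(6), where n = n and \<rho> = \<rho>]) blast+
  have "filled_julia (map_poly of_int P) \<inter> W = {}"
  proof (rule filled_julia_avoids[OF P(3)])
    show "\<rho> > 0" using c d by (simp add: \<rho>_def)
    fix z assume "cmod z > \<rho>"
    then have "cmod (z - x) \<ge> d" if "x \<in> E" for x
      using norm_triangle_ineq2[of z x] c(2)[OF that] by (simp add: \<rho>_def)
    then show "z \<in> W" by (simp add: W_def)
  qed
  then show thesis using that[OF P(1,2)] WU by blast
qed

section \<open>The two implications in terms of the Robin constant\<close>

text \<open>This includes the value \<open>- \<infinity>\<close>, which \<open>real_of_ereal\<close>
  sends to 0, giving capacity 1.\<close>

lemma capacity_ge_1_iff: "capacity E \<ge> 1 \<longleftrightarrow> robin_constant E \<le> 0"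
  by (cases "robin_constant E") (simp_all add: capacity_def)

text \<open>The assumption, applied to the points chosen so far, yields the next one and hence a
  sequence as in \<open>leja_sequence_energy\<close>.\<close>

lemma robin_constant_le_0I:
  fixes E :: "complex set"
  assumes E: "compact E"
    and ex: "\<And>B. \<exists>z\<in>E. cmod (\<Prod>b\<in>#B. z - b) \<ge> 1"
  shows "robin_constant E \<le> 0"
proof -
  obtain next_point where np: "\<And>B. next_point B \<in> E" "\<And>B. cmod (\<Prod>b\<in>#B. next_point B - b) \<ge> 1"
    using ex by metis
  \<comment> \<open>The recursion runs on the multiset of chosen points, since each choice depends
    on all predecessors.\<close>
  define A where "A = rec_nat {#} (\<lambda>_ B. add_mset (next_point B) B)"
  define z where "z n = next_point (A n)" for n
  have A: "A n = image_mset z (mset_set {..<n})" for n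
  proof (induction n)
    case (Suc n)
    have "A (Suc n) = add_mset (z n) (A n)" by (simp add: A_def z_def)
    then show ?case using Suc by (simp add: lessThan_Suc)
  qed (simp add: A_def)
  have "cmod (\<Prod>b\<in>#A n. z n - b) \<ge> 1" for n using np by (simp add: z_def)
  then have "(\<Prod>i<n. cmod (z n - z i)) \<ge> 1" for n
    by (simp add: A prod_unfold_prod_mset norm_prod_mset image_mset.compositionality o_def)
  moreover have "z n \<in> E" for n using np by (simp add: z_def)
  ultimately obtain \<nu> where "\<nu> \<in> prob_measures_on E" "log_energy \<nu> \<le> 0"
    using leja_sequence_energy[OF E, of z] by blast
  then show ?thesis unfolding robin_constant_def by (rule INF_lower2)
qed

text \<open>Otherwise some product of linear factors is below 1 in modulus on \<open>E\<close>. Its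
  lemniscate is an open neighbourhood of the hull, contradicting
  \<open>filled_julia_not_in_lemniscate\<close>.\<close>

lemma capacity_from_filled_julia:
  fixes E :: "complex set"
  assumes E: "compact E"
    and ex: "\<And>U. open U \<Longrightarrow> poly_convex_hull E \<subseteq> U \<Longrightarrow>
      \<exists>p :: complex poly. lead_coeff p = 1 \<and> degree p \<ge> 2 \<and> filled_julia p \<subseteq> U"
  shows "robin_constant E \<le> 0"
proof (rule robin_constant_le_0I[OF E], rule ccontr)
  fix B assume "\<not> (\<exists>z\<in>E. cmod (\<Prod>b\<in>#B. z - b) \<ge> 1)"
  then have less: "cmod (poly (\<Prod>b\<in>#B. [:-b, 1:]) z) < 1" if "z \<in> E" for z
    using that by (force simp: poly_prod_mset_linear)
  have "poly_convex_hull E \<subseteq> {z. cmod (poly (\<Prod>b\<in>#B. [:-b, 1:]) z) < 1}"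
    by (rule lemniscate_contains_poly_convex_hull[OF E less]) (auto intro!: holomorphic_intros)
  moreover have "open {z. cmod (poly (\<Prod>b\<in>#B. [:-b, 1:]) z) < 1}"
    by (intro open_Collect_less continuous_intros)
  ultimately obtain p :: "complex poly" where "lead_coeff p = 1" "degree p \<ge> 2"
    "filled_julia p \<subseteq> {z. cmod (\<Prod>b\<in>#B. z - b) < 1}"
    using ex unfolding poly_prod_mset_linear by blast
  then show False by (rule filled_julia_not_in_lemniscate)
qed

theorem theorem1:
  fixes E :: "complex set"
  assumes "compact E"
    and "\<forall>z\<in>E. cnj z \<in> E"
    and "regular_for_dirichlet E"
  shows "capacity E \<ge> 1 \<longleftrightarrow>
    (\<forall>U. open U \<and> poly_convex_hull E \<subseteq> U \<longrightarrow>
      (\<exists>P :: nat \<Rightarrow> int poly.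
         (\<forall>n. lead_coeff (P n) = 1) \<and>
         filterlim (\<lambda>n. degree (P n)) at_top sequentially \<and>
         (\<forall>\<^sub>F n in sequentially. filled_julia (map_poly of_int (P n)) \<subseteq> U)))"
    (is "?L \<longleftrightarrow> (\<forall>U. open U \<and> poly_convex_hull E \<subseteq> U \<longrightarrow> ?R U)")
proof
  assume ?L
  then have rob: "robin_constant E \<le> 0" by (simp add: capacity_ge_1_iff)
  show "\<forall>U. open U \<and> poly_convex_hull E \<subseteq> U \<longrightarrow> ?R U"
  proof (intro allI impI)
    fix U assume U: "open U \<and> poly_convex_hull E \<subseteq> U"
    have "E \<subseteq> poly_convex_hull E" by (simp add: poly_convex_hull_def flip: union_with_inside)
    then have "\<exists>P :: int poly. lead_coeff P = 1 \<and> degree P \<ge> n \<and> filled_julia (map_poly of_int P) \<subseteq> U" for n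
      using integer_polynomials_from_capacity[OF assms(1,2) rob, of U n] U by (metis subset_trans)
    then obtain P :: "nat \<Rightarrow> int poly" where P: "\<And>n. lead_coeff (P n) = 1" "\<And>n. degree (P n) \<ge> n"
      "\<And>n. filled_julia (map_poly of_int (P n)) \<subseteq> U" by metis
    have "filterlim (\<lambda>n. degree (P n)) at_top sequentially"
      by (rule filterlim_at_top_mono[OF filterlim_ident]) (simp add: P(2))
    then show "?R U" using P by (intro exI[of _ P]) simp
  qed
next
  assume R: "\<forall>U. open U \<and> poly_convex_hull E \<subseteq> U \<longrightarrow> ?R U"
  have "robin_constant E \<le> 0"
  proof (rule capacity_from_filled_julia[OF assms(1)])
    fix U assume "open U" "poly_convex_hull E \<subseteq> U"
    then obtain P :: "nat \<Rightarrow> int poly" where P: "\<And>n. lead_coeff (P n) = 1"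
      "filterlim (\<lambda>n. degree (P n)) at_top sequentially"
      "\<forall>\<^sub>F n in sequentially. filled_julia (map_poly of_int (P n)) \<subseteq> U" using R by blast
    \<comment> \<open>The escape estimate needs degree at least 2, which holds far enough along the
      sequence.\<close>
    have "\<forall>\<^sub>F n in sequentially. degree (P n) \<ge> 2" using P(2) by (simp add: filterlim_at_top)
    then have "\<forall>\<^sub>F n in sequentially. degree (P n) \<ge> 2 \<and> filled_julia (map_poly of_int (P n)) \<subseteq> U"
      using P(3) by (rule eventually_conj)
    then obtain n where n: "degree (P n) \<ge> 2" "filled_julia (map_poly of_int (P n)) \<subseteq> U"
      by (auto dest: eventually_happens)
    have "degree (map_poly complex_of_int (P n)) = degree (P n)" by (rule degree_map_poly) auto
    then show "\<exists>p :: complex poly. lead_coeff p = 1 \<and> degree p \<ge> 2 \<and> filled_julia p \<subseteq> U"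
      using n P(1)[of n] by (intro exI[of _ "map_poly of_int (P n)"]) (simp add: coeff_map_poly)
  qed
  then show ?L by (simp add: capacity_ge_1_iff)
qed

end
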